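(* Let $V$ be a finite-dimensional superspace over $\mathbb{C}$ and let $k,l,p,q\ge 0$. The collection of scalar products $$(v^*_t,v_s)=\sum_{i\in I}x_{ti}\,x^*_{is},\qquad t\in T,\ s\in S,$$ is a basic set for the $\mathfrak{gl}(V)$-invariants in the algebra $\mathfrak{A}^{p,q}_{k,l}$.
   Context: All superspaces are over $\mathbb{C}$; $V=V_{\bar 0}\oplus V_{\bar 1}$, $\dim V=(n,m)$ means $\dim V_{\bar 0}=n$, $\dim V_{\bar 1}=m$; $\Pi$ is the parity shift. Let $U,W$ be superspaces with $\dim U=(k,l)$, $\dim W=(p,q)$ and set $$\mathfrak{A}^{p,q}_{k,l}=S^{\bullet}(V^{k}\oplus\Pi(V)^{l}\oplus V^{*p}\oplus\Pi(V)^{*q})=S^{\bullet}(U\otimes V\oplus V^*\otimes W),$$ where $S^\bullet$ is the symmetric algebra in the super sense. The Lie superalgebras $\mathfrak{gl}(V)$, $\mathfrak{gl}(U)$, $\mathfrak{gl}(W)$ act on it by superderivations; the actions of $\mathfrak{gl}(U)$ and $\mathfrak{gl}(W)$ commute (in the super sense) with that of $\mathfrak{gl}(V)$. For a Lie subsuperalgebra $\mathfrak g\subset\mathfrak{gl}(V)$, an element is $\mathfrak g$-invariant if it is annihilated by $\mathfrak g$. Polarization operators are the operators on $\mathfrak{A}^{p,q}_{k,l}$ given by elements of the universal enveloping algebra $U(\mathfrak{gl}(U)\oplus\mathfrak{gl}(W))$. A set $\mathfrak M$ of $\mathfrak g$-invariants is called basic if the algebra of $\mathfrak g$-invariants coincides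 with the least subalgebra containing $\mathfrak M$ and stable under all polarization operators. Index sets: $T=\{1,\dots,k,\bar1,\dots,\bar l\}$, $S=\{1,\dots,p,\bar1,\dots,\bar q\}$, $I=\{1,\dots,n,\bar1,\dots,\bar m\}$; barred elements are odd, unbarred are even. Choose homogeneous bases $\{u_t\}_{t\in T}$ of $U$, $\{w_s\}_{s\in S}$ of $W$, $\{e_i\}_{i\in I}$ of $V$ (the parity of a basis vector is that of its index), and let $\{e^*_i\}$ be the basis of $V^*$ dual to $\{e_i\}$, $e_i^*(e_j)=\delta_{ij}$. Put $x_{ti}=u_t\otimes e_i$, $x^*_{is}=e^*_i\otimes w_s$. *)

theory Defs
  imports Complex_Main "HOL-Library.Poly_Mapping"
begin

section \<open>The symmetric superalgebra on homogeneous generators\<close>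

class superindex =
  fixes is_odd :: "'a \<Rightarrow> bool"

text \<open>The sign \<open>(-1) ^ (a b)\<close> for two parities, with \<open>True\<close> standing for the odd parity.
  Parities are added by \<open>\<noteq>\<close> on booleans.\<close>

definition koszul :: "bool \<Rightarrow> bool \<Rightarrow> complex"
  where "koszul a b = (if a \<and> b then -1 else 1)"

text \<open>Words under concatenation form the free monoid, so \<open>'g tensor\<close> with the convolution
  product of \<open>Poly_Mapping\<close> is the tensor algebra of the vector space with basis \<open>'g\<close>.\<close>

datatype 'g word = Word (letters: "'g list")

instantiation word :: (type) monoid_add
begin
definition zero_word :: "'a word" where "zero_word = Word []"
definition plus_word :: "'a word \<Rightarrow> 'a word \<Rightarrow> 'a word"
  where "plus_word u v = Word (letters u @ letters v)"
instance by standard (simp_all add: zero_word_def plus_word_def)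
end

type_synonym 'g tensor = "'g word \<Rightarrow>\<^sub>0 complex"

definition tscalar :: "complex \<Rightarrow> 'g tensor"
  where "tscalar c = Poly_Mapping.single 0 c"

definition tword :: "'g list \<Rightarrow> 'g tensor"
  where "tword w = Poly_Mapping.single (Word w) 1"

text \<open>The two-sided ideal generated by the supercommutators of the generators.\<close>

inductive_set supercomm_ideal :: "('g::superindex) tensor set" where
  supercomm: "tword [g, h] - tscalar (koszul (is_odd g) (is_odd h)) * tword [h, g]
    \<in> supercomm_ideal"
| zero: "0 \<in> supercomm_ideal"
| add: "x \<in> supercomm_ideal \<Longrightarrow> y \<in> supercomm_ideal \<Longrightarrow> x + y \<in> supercomm_ideal"
| mult: "x \<in> supercomm_ideal \<Longrightarrow> a * x * b \<in> supercomm_ideal"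

lemma supercomm_ideal_multL: "x \<in> supercomm_ideal \<Longrightarrow> a * x \<in> supercomm_ideal"
  using supercomm_ideal.mult[of x a 1] by simp

lemma supercomm_ideal_multR: "x \<in> supercomm_ideal \<Longrightarrow> x * b \<in> supercomm_ideal"
  using supercomm_ideal.mult[of x 1 b] by simp

lemma supercomm_ideal_uminus: "x \<in> supercomm_ideal \<Longrightarrow> - x \<in> supercomm_ideal"
  using supercomm_ideal_multL[of x "-1"] by simp

lemma supercomm_ideal_sum:
  "(\<And>i. i \<in> A \<Longrightarrow> f i \<in> supercomm_ideal) \<Longrightarrow> sum f A \<in> supercomm_ideal"
  by (induction A rule: infinite_finite_induct) (auto intro: supercomm_ideal.intros)

quotient_type (overloaded) 'g symalg =
  "('g::superindex) tensor" / "\<lambda>x y. x - y \<in> supercomm_ideal"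
proof (rule equivpI)
  show "reflp (\<lambda>x y. x - y \<in> (supercomm_ideal :: 'g tensor set))"
    by (simp add: reflp_def supercomm_ideal.zero)
  show "symp (\<lambda>x y. x - y \<in> (supercomm_ideal :: 'g tensor set))"
    by (rule sympI, drule supercomm_ideal_uminus) simp
  show "transp (\<lambda>x y. x - y \<in> (supercomm_ideal :: 'g tensor set))"
    by (rule transpI, drule (1) supercomm_ideal.add) simp
qed

instantiation symalg :: (superindex) ring
begin

lift_definition zero_symalg :: "'a symalg" is 0 .

lift_definition plus_symalg :: "'a symalg \<Rightarrow> 'a symalg \<Rightarrow> 'a symalg" is "(+)"
  by (simp only: add_diff_add supercomm_ideal.add)

lift_definition uminus_symalg :: "'a symalg \<Rightarrow> 'a symalg" is uminus
  by (simp only: minus_diff_minus supercomm_ideal_uminus)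

lift_definition minus_symalg :: "'a symalg \<Rightarrow> 'a symalg \<Rightarrow> 'a symalg" is "(-)"
proof -
  fix x x' y y' :: "'a tensor"
  assume "x - x' \<in> supercomm_ideal" "y - y' \<in> supercomm_ideal"
  then have "(x - x') + - (y - y') \<in> supercomm_ideal"
    by (intro supercomm_ideal.add supercomm_ideal_uminus)
  also have "(x - x') + - (y - y') = x - y - (x' - y')" by simp
  finally show "x - y - (x' - y') \<in> supercomm_ideal" .
qed

lift_definition times_symalg :: "'a symalg \<Rightarrow> 'a symalg \<Rightarrow> 'a symalg" is "(*)"
proof -
  fix x x' y y' :: "'a tensor"
  assume "x - x' \<in> supercomm_ideal" "y - y' \<in> supercomm_ideal"
  then have "(x - x') * y + x' * (y - y') \<in> supercomm_ideal"
    by (simp add: supercomm_ideal.add supercomm_ideal_multL supercomm_ideal_multR)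
  also have "(x - x') * y + x' * (y - y') = x * y - x' * y'"
    by (simp add: left_diff_distrib right_diff_distrib)
  finally show "x * y - x' * y' \<in> supercomm_ideal" .
qed

instance
proof
  fix a b c :: "'a symalg"
  show "a + b + c = a + (b + c)" by transfer (simp add: add.assoc supercomm_ideal.zero)
  show "a + b = b + a" by transfer (simp add: add.commute supercomm_ideal.zero)
  show "0 + a = a" by transfer (simp add: supercomm_ideal.zero)
  show "- a + a = 0" by transfer (simp add: supercomm_ideal.zero)
  show "a - b = a + - b" by transfer (simp add: supercomm_ideal.zero)
  show "a * b * c = a * (b * c)" by transfer (simp add: mult.assoc supercomm_ideal.zero)
  show "(a + b) * c = a * c + b * c" by transfer (simp add: distrib_right supercomm_ideal.zero)
  show "a * (b + c) = a * b + a * c" by transfer (simp add: distrib_left supercomm_ideal.zero)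
qed

end

instantiation symalg :: (superindex) "monoid_mult"
begin
lift_definition one_symalg :: "'a symalg" is 1 .
instance
proof
  fix a :: "'a symalg"
  show "1 * a = a" by transfer (simp add: supercomm_ideal.zero)
  show "a * 1 = a" by transfer (simp add: supercomm_ideal.zero)
qed
end

lift_definition scale :: "complex \<Rightarrow> ('g::superindex) symalg \<Rightarrow> 'g symalg"
  is "\<lambda>c x. tscalar c * x"
  by (simp only: right_diff_distrib[symmetric] supercomm_ideal_multL)

lift_definition sgen :: "'g::superindex \<Rightarrow> 'g symalg" is "\<lambda>g. tword [g]" .

definition is_subalgebra :: "('g::superindex) symalg set \<Rightarrow> bool" where
  "is_subalgebra B \<longleftrightarrow> 1 \<in> B \<and> (\<forall>a\<in>B. \<forall>b\<in>B. a + b \<in> B \<and> a * b \<in> B)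
     \<and> (\<forall>c. \<forall>a\<in>B. scale c a \<in> B)"

section \<open>Superderivations\<close>

text \<open>A linear endomorphism of the space of generators is given by the images
  \<open>\<phi> g\<close> of the generators. The function below computes, on words, the parity \<open>d\<close> superderivation
  that extends the component of parity \<open>d\<close> of \<open>\<phi>\<close>.\<close>

fun der_word :: "bool \<Rightarrow> ('g::superindex \<Rightarrow> 'g \<Rightarrow>\<^sub>0 complex) \<Rightarrow> 'g list \<Rightarrow> 'g tensor" where
  "der_word d \<phi> [] = 0"
| "der_word d \<phi> (g # w) =
     (\<Sum>h \<in> {h \<in> Poly_Mapping.keys (\<phi> g). is_odd h = (is_odd g \<noteq> d)}.
        tscalar (Poly_Mapping.lookup (\<phi> g) h) * tword (h # w))
     + tscalar (koszul d (is_odd g)) * tword [g] * der_word d \<phi> w"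

definition linext :: "('g list \<Rightarrow> 'g tensor) \<Rightarrow> 'g tensor \<Rightarrow> 'g tensor"
  where "linext F x = (\<Sum>w \<in> Poly_Mapping.keys x. tscalar (Poly_Mapping.lookup x w) * F (letters w))"

definition tensor_der ::
    "bool \<Rightarrow> ('g::superindex \<Rightarrow> 'g \<Rightarrow>\<^sub>0 complex) \<Rightarrow> 'g tensor \<Rightarrow> 'g tensor"
  where "tensor_der d \<phi> = linext (der_word d \<phi>)"

lemma tscalar_0 [simp]: "tscalar 0 = 0" by (simp add: tscalar_def)
lemma tscalar_1 [simp]: "tscalar 1 = 1" by (simp add: tscalar_def)
lemma tscalar_add: "tscalar (a + b) = tscalar a + tscalar b"
  by (simp add: tscalar_def single_add)
lemma tscalar_mult: "tscalar (a * b) = tscalar a * tscalar b"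
  by (simp add: tscalar_def mult_single)
lemma tword_Nil [simp]: "tword [] = 1"
  by (simp add: tword_def flip: zero_word_def)
lemma tword_append: "tword (u @ v) = tword u * tword v"
  by (simp add: tword_def mult_single plus_word_def)
lemma tword_Cons: "tword (g # v) = tword [g] * tword v"
  using tword_append[of "[g]" v] by simp

lemma single_eq: "Poly_Mapping.single w c = tscalar c * tword (letters w)"
  by (simp add: tscalar_def tword_def mult_single)

lemma tensor_expand:
  fixes x :: "'g tensor"
  shows "x = (\<Sum>w \<in> Poly_Mapping.keys x. tscalar (Poly_Mapping.lookup x w) * tword (letters w))"
proof (rule poly_mapping_eqI)
  fix k
  have "Poly_Mapping.lookup (\<Sum>w \<in> Poly_Mapping.keys x. tscalar (Poly_Mapping.lookup x w) * tword (letters w)) k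
      = (\<Sum>w \<in> Poly_Mapping.keys x. Poly_Mapping.lookup x w when w = k)"
    by (simp add: lookup_sum lookup_single flip: single_eq)
  also have "\<dots> = Poly_Mapping.lookup x k"
    by (simp add: when_def in_keys_iff)
  finally show "Poly_Mapping.lookup x k = Poly_Mapping.lookup (\<Sum>w \<in> Poly_Mapping.keys x. tscalar (Poly_Mapping.lookup x w) * tword (letters w)) k" ..
qed

lemma tensor_induct [case_names word add scal]:
  fixes x :: "'g tensor"
  assumes w: "\<And>w. P (tword w)" and a: "\<And>x y. P x \<Longrightarrow> P y \<Longrightarrow> P (x + y)"
    and s: "\<And>c x. P x \<Longrightarrow> P (tscalar c * x)"
  shows "P x"
proof -
  have z: "P 0" using s[OF w, of 0 "[]"] by simp
  have "finite A \<Longrightarrow> P (\<Sum>w \<in> A. tscalar (Poly_Mapping.lookup x w) * tword (letters w))" for A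
    by (induction A rule: finite_induct) (auto intro: z w a s)
  then show ?thesis using tensor_expand[of x] by (metis finite_keys)
qed

lemma linext_superset:
  assumes "finite A" "Poly_Mapping.keys x \<subseteq> A"
  shows "linext F x = (\<Sum>w \<in> A. tscalar (Poly_Mapping.lookup x w) * F (letters w))"
  unfolding linext_def using assms
  by (intro sum.mono_neutral_left) (auto simp: in_keys_iff)

lemma linext_add: "linext F (x + y) = linext F x + linext F y"
proof -
  let ?A = "Poly_Mapping.keys x \<union> Poly_Mapping.keys y"
  have "Poly_Mapping.keys (x + y) \<subseteq> ?A" by (rule keys_add)
  then show ?thesis
    by (simp add: linext_superset[of ?A] lookup_add tscalar_add distrib_right sum.distrib)
qed

lemma lookup_tscalar_mult: "Poly_Mapping.lookup (tscalar c * x) w = c * Poly_Mapping.lookup x w"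
  unfolding tscalar_def by (simp flip: mult_map_scale_conv_mult add: map.rep_eq when_def)

lemma linext_scal: "linext F (tscalar c * x) = tscalar c * linext F x"
proof -
  have "Poly_Mapping.keys (tscalar c * x) \<subseteq> Poly_Mapping.keys x" by (auto simp: in_keys_iff lookup_tscalar_mult)
  then show ?thesis
    by (simp add: linext_superset[of "Poly_Mapping.keys x"] lookup_tscalar_mult tscalar_mult sum_distrib_left
        mult.assoc)
qed

lemma linext_tword: "linext F (tword w) = F w"
  by (simp add: linext_def tword_def)

lemma tscalar_commute: "x * tscalar c = tscalar c * x"
proof (induction x rule: tensor_induct)
  case (word w)
  then show ?case by (simp add: tscalar_def tword_def mult_single)
next
  case (scal d x)
  have "tscalar d * x * tscalar c = tscalar (d * c) * x"
    by (simp only: mult.assoc scal tscalar_mult)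
  also have "\<dots> = tscalar c * (tscalar d * x)"
    by (simp only: mult.assoc[symmetric] tscalar_mult[symmetric] mult.commute[of d c])
  finally show ?case .
qed (simp add: distrib_left distrib_right)

lemma tscalar_left_commute: "x * (tscalar c * y) = tscalar c * (x * y)"
  by (simp only: mult.assoc[symmetric] tscalar_commute)

lemma tscalar_tscalar: "tscalar a * (tscalar b * x) = tscalar (a * b) * x"
  by (simp add: tscalar_mult mult.assoc)

lemmas tword_tscalar = tscalar_left_commute[of "tword w" for w]

definition parity_sign :: "bool \<Rightarrow> ('g::superindex) list \<Rightarrow> complex"
  where "parity_sign d w = prod_list (map (\<lambda>g. koszul d (is_odd g)) w)"

definition parity_twist :: "bool \<Rightarrow> ('g::superindex) tensor \<Rightarrow> 'g tensor"
  where "parity_twist d = linext (\<lambda>w. tscalar (parity_sign d w) * tword w)"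

lemma parity_twist_mult: "parity_twist d (x * y) = parity_twist d x * parity_twist d y"
proof (induction x rule: tensor_induct)
  case (word u)
  show ?case
  proof (induction y rule: tensor_induct)
    case (word v)
    show ?case
      by (simp add: parity_twist_def linext_tword tword_append[symmetric])
        (simp add: parity_sign_def tword_append tword_tscalar tscalar_tscalar mult.assoc)
  qed (simp_all add: parity_twist_def linext_add linext_scal distrib_left
        tscalar_left_commute[of "linext F u" for F u] tword_tscalar)
qed (simp_all add: parity_twist_def linext_add linext_scal distrib_right mult.assoc)

lemma der_word_append:
  "der_word d \<phi> (u @ v)
    = der_word d \<phi> u * tword v + tscalar (parity_sign d u) * tword u * der_word d \<phi> v"
proof (induction u)
  case (Cons g u)
  have *: "tword (h # u @ v) = tword (h # u) * tword v" for h
    using tword_append[of "h # u" v] by simp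
  show ?case
    unfolding append_Cons der_word.simps Cons.IH *
    by (simp add: parity_sign_def tword_Cons[of g u] tscalar_tscalar tword_tscalar
        distrib_left distrib_right mult.assoc sum_distrib_right)
qed (simp add: parity_sign_def)

lemma tensor_der_mult:
  "tensor_der d \<phi> (x * y) = tensor_der d \<phi> x * y + parity_twist d x * tensor_der d \<phi> y"
proof (induction x rule: tensor_induct)
  case (word u)
  show ?case
  proof (induction y rule: tensor_induct)
    case (word v)
    show ?case
      by (simp add: tensor_der_def parity_twist_def linext_tword tword_append[symmetric]
          der_word_append)
  qed (simp_all add: tensor_der_def parity_twist_def linext_add linext_scal distrib_left
        tscalar_left_commute[of "linext F u" for F u] tword_tscalar)
qed (simp_all add: tensor_der_def parity_twist_def linext_add linext_scal distrib_left distrib_right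
      mult.assoc)

lemma linext_diff: "linext F (x - y) = linext F x - linext F y"
  using linext_add[of F "x - y" y] by simp

lemma linext_0 [simp]: "linext F 0 = 0"
  by (simp add: linext_def)

lemma supercomm':
  "tword [g] * tword [h] - tscalar (koszul (is_odd g) (is_odd h)) * (tword [h] * tword [g])
    \<in> supercomm_ideal"
  using supercomm_ideal.supercomm[of g h] tword_append[of "[g]" "[h]"] tword_append[of "[h]" "[g]"]
  by simp

lemma parity_twist_ideal: "x \<in> supercomm_ideal \<Longrightarrow> parity_twist d x \<in> supercomm_ideal"
proof (induction rule: supercomm_ideal.induct)
  case (supercomm g h)
  have "parity_twist d (tword [g, h] - tscalar (koszul (is_odd g) (is_odd h)) * tword [h, g])
     = tscalar (parity_sign d [g, h])
        * (tword [g, h] - tscalar (koszul (is_odd g) (is_odd h)) * tword [h, g])"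
    by (simp add: parity_twist_def linext_diff linext_scal linext_tword)
      (simp add: parity_sign_def right_diff_distrib tscalar_tscalar mult.commute)
  then show ?case by (simp add: supercomm_ideal_multL supercomm_ideal.supercomm)
qed (auto simp: parity_twist_mult intro: supercomm_ideal.intros,
    auto simp: parity_twist_def linext_add intro: supercomm_ideal.intros)

lemma tensor_der_supercomm:
  fixes g h :: "'a::superindex"
  shows "tensor_der d \<phi> (tword [g, h] - tscalar (koszul (is_odd g) (is_odd h)) * tword [h, g])
    \<in> supercomm_ideal"
proof -
  define K where "K = (\<lambda>g. {h \<in> Poly_Mapping.keys (\<phi> g). is_odd h = (is_odd g \<noteq> d)})"
  define c where "c = (\<lambda>(a :: 'a) (b :: 'a). tscalar (koszul (is_odd a) (is_odd b)) :: 'a tensor)"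
  define D where "D = (\<lambda>g. \<Sum>h\<in>K g. tscalar (Poly_Mapping.lookup (\<phi> g) h) * tword [h])"
  let ?k = "\<lambda>g. tscalar (koszul d (is_odd g)) :: 'a tensor"
  have D1: "tensor_der d \<phi> (tword [g, h]) = D g * tword [h] + ?k g * tword [g] * D h" for g h
    by (simp add: tensor_der_def linext_tword D_def K_def)
      (simp add: tword_Cons[of _ "[h]"] sum_distrib_right mult.assoc)
  have A: "D g * tword [h] - tscalar (koszul (is_odd g \<noteq> d) (is_odd h)) * (tword [h] * D g)
      \<in> supercomm_ideal" for g h
  proof -
    have "D g * tword [h] - tscalar (koszul (is_odd g \<noteq> d) (is_odd h)) * (tword [h] * D g)
      = (\<Sum>a\<in>K g. tscalar (Poly_Mapping.lookup (\<phi> g) a) * (tword [a] * tword [h] - c a h * (tword [h] * tword [a])))"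
      unfolding D_def c_def K_def
      by (simp add: sum_distrib_right sum_distrib_left sum_subtractf right_diff_distrib mult.assoc
          tword_tscalar tscalar_tscalar mult.commute[of "koszul _ _"] cong: conj_cong)
    also have "\<dots> \<in> supercomm_ideal"
      unfolding c_def by (intro supercomm_ideal_sum supercomm_ideal_multL supercomm')
    finally show ?thesis .
  qed
  let ?s = "tscalar (koszul (is_odd g \<noteq> d) (is_odd h)) :: 'a tensor"
  let ?t = "tscalar (koszul (is_odd h \<noteq> d) (is_odd g)) :: 'a tensor"
  let ?X = "D g * tword [h] - ?s * (tword [h] * D g)"
  let ?Y = "D h * tword [g] - ?t * (tword [g] * D h)"
  have s: "c g h * (?k h * z) = ?s * z" for z
    unfolding c_def tscalar_tscalar by (simp add: koszul_def)
  have t: "c g h * (?t * z) = ?k g * z" for z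
    unfolding c_def tscalar_tscalar by (simp add: koszul_def)
  have "tensor_der d \<phi> (tword [g, h] - c g h * tword [h, g]) =
      D g * tword [h] + ?k g * tword [g] * D h
      - c g h * (D h * tword [g] + ?k h * tword [h] * D g)"
    unfolding c_def by (simp add: D1[symmetric]) (simp add: tensor_der_def linext_diff linext_scal)
  also have "\<dots> = ?X - c g h * ?Y"
    by (simp only: distrib_left right_diff_distrib mult.assoc s t) simp
  also have "\<dots> = ?X + - (c g h * ?Y)" by simp
  also have "\<dots> \<in> supercomm_ideal"
    by (intro supercomm_ideal.add supercomm_ideal_uminus supercomm_ideal_multL A)
  finally show ?thesis unfolding c_def .
qed

lemma tensor_der_ideal: "x \<in> supercomm_ideal \<Longrightarrow> tensor_der d \<phi> x \<in> supercomm_ideal"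
proof (induction rule: supercomm_ideal.induct)
  case (supercomm g h)
  show ?case by (rule tensor_der_supercomm)
next
  case (mult x a b)
  then show ?case
    by (auto simp: tensor_der_mult parity_twist_mult intro!: supercomm_ideal.add
        intro: supercomm_ideal_multL supercomm_ideal_multR parity_twist_ideal)
qed (simp_all add: tensor_der_def linext_add supercomm_ideal.intros)

lift_definition hom_superder ::
    "bool \<Rightarrow> ('g::superindex \<Rightarrow> 'g \<Rightarrow>\<^sub>0 complex) \<Rightarrow> 'g symalg \<Rightarrow> 'g symalg" is tensor_der
  by (simp add: tensor_der_def linext_diff[symmetric]) (simp add: tensor_der_ideal flip: tensor_der_def)

definition superder ::
    "('g::superindex \<Rightarrow> 'g \<Rightarrow>\<^sub>0 complex) \<Rightarrow> 'g symalg \<Rightarrow> 'g symalg"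
  where "superder \<phi> a = hom_superder False \<phi> a + hom_superder True \<phi> a"

section \<open>The algebra \<open>S(U \<otimes> V \<oplus> V\<^sup>* \<otimes> W)\<close>\<close>

datatype idx = Even nat | Odd nat

instantiation idx :: superindex
begin
fun is_odd_idx :: "idx \<Rightarrow> bool" where
  "is_odd_idx (Even _) = False"
| "is_odd_idx (Odd _) = True"
instance ..
end

definition idx_set :: "nat \<Rightarrow> nat \<Rightarrow> idx set"
  where "idx_set a b = Even ` {1..a} \<union> Odd ` {1..b}"

text \<open>\<open>X t i\<close> stands for \<open>u\<^sub>t \<otimes> e\<^sub>i\<close> and \<open>Xd i s\<close> for \<open>e\<^sub>i\<^sup>* \<otimes> w\<^sub>s\<close>.\<close>

datatype gen = X idx idx | Xd idx idx

instantiation gen :: superindex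
begin
fun is_odd_gen :: "gen \<Rightarrow> bool" where
  "is_odd_gen (X t i) = (is_odd t \<noteq> is_odd i)"
| "is_odd_gen (Xd i s) = (is_odd i \<noteq> is_odd s)"
instance ..
end

text \<open>The type \<open>gen symalg\<close> has generators for all indices; for index sets \<open>T\<close>, \<open>S\<close>, \<open>I\<close> of bases
  of \<open>U\<close>, \<open>W\<close>, \<open>V\<close> the symmetric superalgebra of \<open>U \<otimes> V \<oplus> V\<^sup>* \<otimes> W\<close> is the subalgebra generated
  by the elements of this space, just as \<open>k[x\<^sub>1, \<dots>, x\<^sub>r]\<close> sits in a polynomial ring with more
  variables. (No new relations arise, as sending the other generators to \<open>0\<close> is a retraction.)\<close>

definition mixed_algebra :: "idx set \<Rightarrow> idx set \<Rightarrow> idx set \<Rightarrow> gen symalg set" where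
  "mixed_algebra T S I = is_subalgebra hull
     ({sgen (X t i) | t i. t \<in> T \<and> i \<in> I} \<union> {sgen (Xd i s) | i s. i \<in> I \<and> s \<in> S})"

text \<open>Endomorphisms of the space with basis \<open>J\<close>, as matrices: \<open>A e\<^sub>j = (\<Sum>i\<in>J. A i j e\<^sub>i)\<close>.
  The entry \<open>A i j\<close> belongs to the component of parity \<open>is_odd i + is_odd j\<close>.\<close>

definition gl :: "idx set \<Rightarrow> (idx \<Rightarrow> idx \<Rightarrow> complex) set"
  where "gl J = {A. \<forall>i j. A i j \<noteq> 0 \<longrightarrow> i \<in> J \<and> j \<in> J}"

text \<open>For homogeneous \<open>A\<close>: \<open>A (u \<otimes> v) = (-1) ^ (p(A) p(u)) u \<otimes> A v\<close> on \<open>U \<otimes> V\<close>, and on the dual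
  space \<open>(A f) v = - (-1) ^ (p(A) p(f)) f (A v)\<close>.\<close>

fun gl_V_gen :: "idx set \<Rightarrow> (idx \<Rightarrow> idx \<Rightarrow> complex) \<Rightarrow> gen \<Rightarrow> gen \<Rightarrow>\<^sub>0 complex" where
  "gl_V_gen I A (X t i) = (\<Sum>j\<in>I. Poly_Mapping.single (X t j)
     (koszul (is_odd j \<noteq> is_odd i) (is_odd t) * A j i))"
| "gl_V_gen I A (Xd i s) = (\<Sum>j\<in>I. Poly_Mapping.single (Xd j s)
     (- koszul (is_odd i \<noteq> is_odd j) (is_odd i) * A i j))"

fun gl_U_gen :: "idx set \<Rightarrow> (idx \<Rightarrow> idx \<Rightarrow> complex) \<Rightarrow> gen \<Rightarrow> gen \<Rightarrow>\<^sub>0 complex" where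
  "gl_U_gen T A (X t i) = (\<Sum>r\<in>T. Poly_Mapping.single (X r i) (A r t))"
| "gl_U_gen T A (Xd i s) = 0"

fun gl_W_gen :: "idx set \<Rightarrow> (idx \<Rightarrow> idx \<Rightarrow> complex) \<Rightarrow> gen \<Rightarrow> gen \<Rightarrow>\<^sub>0 complex" where
  "gl_W_gen S A (X t i) = 0"
| "gl_W_gen S A (Xd i s) = (\<Sum>r\<in>S. Poly_Mapping.single (Xd i r)
     (koszul (is_odd r \<noteq> is_odd s) (is_odd i) * A r s))"

definition invariants ::
    "idx set \<Rightarrow> idx set \<Rightarrow> idx set \<Rightarrow> (idx \<Rightarrow> idx \<Rightarrow> complex) set \<Rightarrow> gen symalg set"
  where "invariants T S I \<gg> =
    {a \<in> mixed_algebra T S I. \<forall>A\<in>\<gg>. superder (gl_V_gen I A) a = 0}"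

text \<open>The enveloping algebra of \<open>gl(U) \<oplus> gl(W)\<close> is generated by \<open>gl(U)\<close> and \<open>gl(W)\<close> as a unital
  associative algebra, so the operators given by its elements are obtained from those
  of \<open>gl(U)\<close> and \<open>gl(W)\<close> by the following closure.\<close>

inductive_set polarization_ops :: "idx set \<Rightarrow> idx set \<Rightarrow> (gen symalg \<Rightarrow> gen symalg) set"
  for T S :: "idx set" where
  gl_U: "A \<in> gl T \<Longrightarrow> superder (gl_U_gen T A) \<in> polarization_ops T S"
| gl_W: "A \<in> gl S \<Longrightarrow> superder (gl_W_gen S A) \<in> polarization_ops T S"
| one: "id \<in> polarization_ops T S"
| scale: "P \<in> polarization_ops T S \<Longrightarrow> (\<lambda>a. scale c (P a)) \<in> polarization_ops T S"
| add: "P \<in> polarization_ops T S \<Longrightarrow> Q \<in> polarization_ops T S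
    \<Longrightarrow> (\<lambda>a. P a + Q a) \<in> polarization_ops T S"
| mult: "P \<in> polarization_ops T S \<Longrightarrow> Q \<in> polarization_ops T S
    \<Longrightarrow> P \<circ> Q \<in> polarization_ops T S"

definition polarization_stable :: "idx set \<Rightarrow> idx set \<Rightarrow> gen symalg set \<Rightarrow> bool"
  where "polarization_stable T S B \<longleftrightarrow> (\<forall>P \<in> polarization_ops T S. P ` B \<subseteq> B)"

definition basic_set ::
    "idx set \<Rightarrow> idx set \<Rightarrow> idx set \<Rightarrow> (idx \<Rightarrow> idx \<Rightarrow> complex) set \<Rightarrow> gen symalg set \<Rightarrow> bool"
  where "basic_set T S I \<gg> M \<longleftrightarrow> M \<subseteq> invariants T S I \<gg> \<and>
    invariants T S I \<gg> =
      (\<lambda>B. B \<subseteq> mixed_algebra T S I \<and> is_subalgebra B \<and> polarization_stable T S B) hull M"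

definition scalar_product :: "idx set \<Rightarrow> idx \<Rightarrow> idx \<Rightarrow> gen symalg"
  where "scalar_product I t s = (\<Sum>i\<in>I. sgen (X t i) * sgen (Xd i s))"

end

theory Submission
  imports Defs
begin

text \<open>Polarization operators are not needed: every invariant is a linear combination of products of
  scalar products. Let \<open>a\<close> be an invariant; the identity matrix forces it to have the same degree \<open>r\<close>
  in the \<open>x\<close> and in the \<open>x\<^sup>*\<close>.

  If \<open>U\<close> is a copy of \<open>V\<^sup>*\<close>, so that \<open>x\<close> is a generic square supermatrix, then \<open>a\<close> is determined by its
  value at \<open>x = 1\<close>: the action of \<open>gl(V)\<close> on the parameters turns the vanishing of that value into the
  vanishing of all derivatives at \<open>x = 1\<close>. At \<open>x = 1\<close> the scalar products specialize to the \<open>x\<^sup>*\<close>, hence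
  some polynomial in the scalar products has the same value as \<open>a\<close>.

  For arbitrary \<open>U\<close>, adjoin such a copy to \<open>U\<close>. In the Fischer inner product the polarizations
  \<open>x\<^sub>t \<mapsto> x\<^sub>k\<close> and \<open>x\<^sub>k \<mapsto> x\<^sub>t\<close> are adjoint. Let \<open>e\<close> be the component of \<open>a\<close> orthogonal to all products
  of scalar products. An \<open>r\<close>-fold polarization of \<open>e\<close> into the copy is an invariant, thus a polynomial
  in the scalar products by the first case; by adjointness it is orthogonal to itself, so it is \<open>0\<close>.
  Evaluated at \<open>x = 1\<close> these polarizations are the \<open>r\<close>-fold derivatives of \<open>e\<close>, whence \<open>e = 0\<close>.\<close>

section \<open>Linear maps on the symmetric superalgebra\<close>

lemma scale_add_right: "scale c (a + b) = scale c a + scale c b"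
  by transfer (simp add: distrib_left supercomm_ideal.zero)
lemma scale_add_left: "scale (c + d) a = scale c a + scale d a"
  by transfer (simp add: tscalar_add distrib_right supercomm_ideal.zero)
lemma scale_scale: "scale c (scale d a) = scale (c * d) a"
  by transfer (simp add: tscalar_mult mult.assoc supercomm_ideal.zero)
lemma scale_1: "scale 1 a = a"
  by transfer (simp add: supercomm_ideal.zero)

interpretation sv: vector_space "scale :: complex \<Rightarrow> 'g::superindex symalg \<Rightarrow> 'g symalg"
  by standard (simp_all add: scale_add_right scale_add_left scale_scale scale_1)

lemma scale_mult_left: "scale c a * b = scale c (a * b)"
  by transfer (simp add: mult.assoc supercomm_ideal.zero)
lemma scale_mult_right: "a * scale c b = scale c (a * b)"
  by transfer (simp add: tscalar_left_commute supercomm_ideal.zero)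

definition lin :: "('g::superindex symalg \<Rightarrow> 'h::superindex symalg) \<Rightarrow> bool"
  where "lin D \<longleftrightarrow> (\<forall>a b. D (a + b) = D a + D b) \<and> (\<forall>c a. D (scale c a) = scale c (D a))"

lemma linI: "(\<And>a b. D (a + b) = D a + D b) \<Longrightarrow> (\<And>c a. D (scale c a) = scale c (D a)) \<Longrightarrow> lin D"
  by (simp add: lin_def)
lemma lin_add: "lin D \<Longrightarrow> D (a + b) = D a + D b" by (simp add: lin_def)
lemma lin_scale: "lin D \<Longrightarrow> D (scale c a) = scale c (D a)" by (simp add: lin_def)
lemma lin_0: "lin D \<Longrightarrow> D 0 = 0" using lin_scale[of D 0 0] by simp
lemma lin_diff: "lin D \<Longrightarrow> D (a - b) = D a - D b"
  using lin_add[of D "a - b" b] by (simp add: algebra_simps)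
lemma lin_sum: "lin D \<Longrightarrow> D (sum f A) = (\<Sum>x\<in>A. D (f x))"
  by (induction A rule: infinite_finite_induct) (simp_all add: lin_0 lin_add)
lemma lin_comp: "lin D \<Longrightarrow> lin E \<Longrightarrow> lin (\<lambda>a. D (E a))"
  by (simp add: lin_def)

lemma lin_plus: "lin D \<Longrightarrow> lin E \<Longrightarrow> lin (\<lambda>a. D a + E a)"
  by (simp add: lin_def scale_add_right algebra_simps)
lemma lin_minus: "lin D \<Longrightarrow> lin E \<Longrightarrow> lin (\<lambda>a. D a - E a)"
  by (simp add: lin_def sv.scale_right_diff_distrib algebra_simps)
lemma lin_scaled: "lin D \<Longrightarrow> lin (\<lambda>a. scale c (D a))"
  by (simp add: lin_def scale_add_right mult.commute)
lemma lin_multL: "lin (\<lambda>a. x * a)" and lin_multR: "lin (\<lambda>a. a * x)"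
  by (simp_all add: lin_def algebra_simps scale_mult_left scale_mult_right)
lemma lin_id: "lin (\<lambda>a. a)" by (simp add: lin_def)

lemma lin_span:
  assumes "lin D" "a \<in> sv.span A" "\<And>x. x \<in> A \<Longrightarrow> D x \<in> sv.span B"
  shows "D a \<in> sv.span B"
  using assms(2)
  by (induction rule: sv.span_induct_alt)
    (simp_all add: lin_0 lin_add lin_scale assms sv.span_zero sv.span_add sv.span_scale)

lemma lin_eq_on_span:
  assumes "lin D" "lin E" "a \<in> sv.span A" "\<And>x. x \<in> A \<Longrightarrow> D x = E x"
  shows "D a = E a"
  using assms(3)
  by (induction rule: sv.span_induct_alt) (simp_all add: lin_0 lin_add lin_scale assms)

section \<open>Monomials as a spanning set\<close>

definition mon :: "'g::superindex list \<Rightarrow> 'g symalg"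
  where "mon w = prod_list (map sgen w)"

lemma mon_Nil [simp]: "mon [] = 1" and mon_Cons [simp]: "mon (g # w) = sgen g * mon w"
  and mon_append: "mon (u @ v) = mon u * mon v"
  by (simp_all add: mon_def)

lemma abs_tword: "abs_symalg (tword w) = mon w"
proof (induction w)
  case Nil
  then show ?case by (simp add: one_symalg.abs_eq)
next
  case (Cons g w)
  have "abs_symalg (tword [g]) * abs_symalg (tword w) = abs_symalg (tword (g # w))"
    unfolding times_symalg.abs_eq tword_Cons[of g w] ..
  then show ?case unfolding mon_Cons Cons.IH[symmetric] sgen.abs_eq by (rule sym)
qed

lemma span_mon: "a \<in> sv.span (range mon)"
proof -
  have "abs_symalg x \<in> sv.span (range mon)" for x :: "'a tensor"
  proof (induction x rule: tensor_induct)
    case (word w) then show ?case by (simp add: abs_tword sv.span_base)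
  next
    case (add x y) then show ?case by (simp add: plus_symalg.abs_eq[symmetric] sv.span_add)
  next
    case (scal c x) then show ?case by (simp add: scale.abs_eq[symmetric] sv.span_scale)
  qed
  then show ?thesis by (metis Quotient_symalg Quotient_abs_rep)
qed

lemma lin_eqI: "lin D \<Longrightarrow> lin E \<Longrightarrow> (\<And>w. D (mon w) = E (mon w)) \<Longrightarrow> D a = E a"
  by (rule lin_eq_on_span[OF _ _ span_mon]) auto

lemma sgen_commute: "sgen g * sgen h = scale (koszul (is_odd g) (is_odd h)) (sgen h * sgen g)"
  by transfer (rule supercomm')

text \<open>A linear map on the tensor algebra factors through the symmetric superalgebra as soon as it
  respects the exchange of adjacent letters of words.\<close>

lemma ideal_vanish:
  fixes L :: "'g::superindex tensor \<Rightarrow> 'b::ab_group_add"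
  assumes add: "\<And>x y. L (x + y) = L x + L y"
    and scal: "\<And>c x. L x = 0 \<Longrightarrow> L (tscalar c * x) = 0"
    and swap: "\<And>u g h v. L (tword (u @ [g, h] @ v)
      - tscalar (koszul (is_odd g) (is_odd h)) * tword (u @ [h, g] @ v)) = 0"
    and x: "x \<in> supercomm_ideal"
  shows "L x = 0"
proof -
  \<comment> \<open>Vanishing on all multiples \<open>a * x * b\<close> is what survives the rule
    \<open>mult\<close> of the ideal. For a defining relation, linearity in \<open>a\<close> and
    \<open>b\<close> then reduces to words.\<close>
  have "L (a * x * b) = 0" for a b
    using x
  proof (induction arbitrary: a b)
    case (supercomm g h)
    let ?r = "tword [g, h] - tscalar (koszul (is_odd g) (is_odd h)) * tword [h, g]"
    show ?case
    proof (induction a rule: tensor_induct)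
      case (word u)
      show ?case
      proof (induction b rule: tensor_induct)
        case (word v)
        have "tword u * ?r * tword v = tword (u @ [g, h] @ v)
          - tscalar (koszul (is_odd g) (is_odd h)) * tword (u @ [h, g] @ v)"
          unfolding tword_append[of u] tword_append[of "[g, h]"] tword_append[of "[h, g]"]
            right_diff_distrib left_diff_distrib
          by (simp only: tword_tscalar mult.assoc)
        then show ?case by (simp only: swap)
      next
        case (scal c x)
        then show ?case by (simp add: assms(2) tscalar_left_commute)
      qed (simp add: distrib_left add)
    next
      case (scal c x)
      then show ?case by (simp add: assms(2) mult.assoc)
    qed (simp add: distrib_right add)
  next
    case zero
    show ?case using add[of 0 0] by simp
  next
    case (add x y)
    then show ?case by (simp add: distrib_left distrib_right assms(1))
  next
    case (mult x a' b')
    show ?case using mult.IH[of "a * a'" "b' * b"] by (simp add: mult.assoc)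
  qed
  from this[of 1 1] show ?thesis by simp
qed

text \<open>The condition under which the linear extension of a function on words kills the ideal of
  supercommutators, by \<open>ideal_vanish\<close>.\<close>

definition swap_inv :: "('g::superindex list \<Rightarrow> 'h::superindex symalg) \<Rightarrow> bool"
  where "swap_inv F \<longleftrightarrow> (\<forall>u g h v. F (u @ [g, h] @ v)
    = scale (koszul (is_odd g) (is_odd h)) (F (u @ [h, g] @ v)))"

definition tensor_ext :: "('g::superindex list \<Rightarrow> 'h::superindex symalg) \<Rightarrow> 'g tensor \<Rightarrow> 'h symalg"
  where "tensor_ext F x = (\<Sum>w \<in> Poly_Mapping.keys x. scale (Poly_Mapping.lookup x w) (F (letters w)))"

text \<open>The value is read off from an arbitrary representative; by \<open>ext_abs\<close> the
  choice does not matter when \<open>swap_inv F\<close> holds.\<close>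

definition ext :: "('g::superindex list \<Rightarrow> 'h::superindex symalg) \<Rightarrow> 'g symalg \<Rightarrow> 'h symalg"
  where "ext F a = tensor_ext F (rep_symalg a)"

lemma tensor_ext_superset:
  assumes "finite A" "Poly_Mapping.keys x \<subseteq> A"
  shows "tensor_ext F x = (\<Sum>w \<in> A. scale (Poly_Mapping.lookup x w) (F (letters w)))"
  unfolding tensor_ext_def using assms
  by (intro sum.mono_neutral_left) (auto simp: in_keys_iff)

lemma tensor_ext_add: "tensor_ext F (x + y) = tensor_ext F x + tensor_ext F y"
proof -
  let ?A = "Poly_Mapping.keys x \<union> Poly_Mapping.keys y"
  have "Poly_Mapping.keys (x + y) \<subseteq> ?A" by (rule keys_add)
  then show ?thesis
    by (simp add: tensor_ext_superset[of ?A] lookup_add scale_add_left sum.distrib)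
qed

lemma tensor_ext_scal: "tensor_ext F (tscalar c * x) = scale c (tensor_ext F x)"
proof -
  have "Poly_Mapping.keys (tscalar c * x) \<subseteq> Poly_Mapping.keys x"
    by (auto simp: in_keys_iff lookup_tscalar_mult)
  then show ?thesis
    by (simp add: tensor_ext_superset[of "Poly_Mapping.keys x"] lookup_tscalar_mult sv.scale_sum_right)
qed

lemma tensor_ext_tword: "tensor_ext F (tword w) = F w"
  by (simp add: tensor_ext_def tword_def)

lemma tensor_ext_diff: "tensor_ext F (x - y) = tensor_ext F x - tensor_ext F y"
  using tensor_ext_add[of F "x - y" y] by (simp add: algebra_simps)

lemma ext_abs:
  assumes "swap_inv F"
  shows "ext F (abs_symalg x) = tensor_ext F x"
proof -
  have "rep_symalg (abs_symalg x) - x \<in> supercomm_ideal"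
    by (rule Quotient_rep_abs[OF Quotient_symalg]) (simp add: supercomm_ideal.zero)
  then have "tensor_ext F (rep_symalg (abs_symalg x) - x) = 0"
  proof (rule ideal_vanish[of "tensor_ext F", rotated -1])
    show "tensor_ext F (tword (u @ [g, h] @ v)
        - tscalar (koszul (is_odd g) (is_odd h)) * tword (u @ [h, g] @ v)) = 0" for u g h v
      unfolding tensor_ext_diff tensor_ext_scal tensor_ext_tword
      using assms unfolding swap_inv_def by (metis diff_self)
  qed (simp_all add: tensor_ext_add tensor_ext_scal)
  then show ?thesis by (simp add: ext_def tensor_ext_diff)
qed

lemma lin_ext: assumes "swap_inv F" shows "lin (ext F)"
proof (rule linI)
  fix a b :: "'a symalg" and c
  obtain x y where "a = abs_symalg x" "b = abs_symalg y"
    by (metis Quotient_symalg Quotient_abs_rep)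
  then show "ext F (a + b) = ext F a + ext F b" "ext F (scale c a) = scale c (ext F a)"
    by (simp_all add: plus_symalg.abs_eq scale.abs_eq ext_abs assms tensor_ext_add tensor_ext_scal)
qed

lemma ext_mon: "swap_inv F \<Longrightarrow> ext F (mon w) = F w"
  by (simp add: abs_tword[symmetric] ext_abs tensor_ext_tword)

text \<open>The augmentation of the algebra, i.e. the constant term. It is well defined because the
  supercommutators have no constant term. It supplies the degree 0 case of the Fischer form.\<close>

lift_definition counit :: "'g::superindex symalg \<Rightarrow> complex" is "\<lambda>x. Poly_Mapping.lookup x 0"
proof -
  fix x y :: "'g tensor"
  assume "x - y \<in> supercomm_ideal"
  then have "Poly_Mapping.lookup (x - y) 0 = 0"
  proof (rule ideal_vanish[of "\<lambda>x. Poly_Mapping.lookup x 0", rotated -1])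
    show "Poly_Mapping.lookup (tword (u @ [g, h] @ v)
        - tscalar (koszul (is_odd g) (is_odd h)) * tword (u @ [h, g] @ v)) 0 = 0" for u g h v
      by (simp only: lookup_minus lookup_tscalar_mult)
        (simp add: tword_def lookup_single zero_word_def)
  qed (simp_all add: lookup_add lookup_tscalar_mult)
  then show "Poly_Mapping.lookup x 0 = Poly_Mapping.lookup y 0" by (simp add: lookup_minus)
qed

lemma counit_add [simp]: "counit (a + b) = counit a + counit b"
  by transfer (simp add: lookup_add)
lemma counit_scale [simp]: "counit (scale c a) = c * counit a"
  by transfer (simp add: lookup_tscalar_mult)
lemma counit_0 [simp]: "counit 0 = 0"
  by transfer simp
lemma counit_1 [simp]: "counit 1 = 1"
  by transfer (simp add: lookup_one)
lemma counit_mon: "w \<noteq> [] \<Longrightarrow> counit (mon w) = 0"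
  unfolding abs_tword[symmetric] counit.abs_eq
  by (simp add: tword_def lookup_single zero_word_def)

section \<open>Superderivations and partial derivatives\<close>

text \<open>The automorphism that multiplies an element of parity p by \<open>koszul d p\<close>.
  With it the sign in the super Leibniz rule can be written for arbitrary, not only homogeneous,
  factors.\<close>

lift_definition ptwist :: "bool \<Rightarrow> ('g::superindex) symalg \<Rightarrow> 'g symalg" is parity_twist
proof -
  fix d and x y :: "'g tensor"
  assume "x - y \<in> supercomm_ideal"
  then have "parity_twist d (x - y) \<in> supercomm_ideal" by (rule parity_twist_ideal)
  then show "parity_twist d x - parity_twist d y \<in> supercomm_ideal"
    by (simp add: parity_twist_def linext_diff)
qed

lemma lin_ptwist: "lin (ptwist d)"
proof (rule linI)
  show "ptwist d (a + b) = ptwist d a + ptwist d b" for a b :: "'a symalg"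
    by transfer (simp add: parity_twist_def linext_add supercomm_ideal.zero)
  show "ptwist d (scale c a) = scale c (ptwist d a)" for a :: "'a symalg" and c
    by transfer (simp add: parity_twist_def linext_scal supercomm_ideal.zero)
qed

lemma ptwist_mult: "ptwist d (a * b) = ptwist d a * ptwist d b"
  by transfer (simp add: parity_twist_mult supercomm_ideal.zero)

lemma ptwist_1 [simp]: "ptwist d 1 = 1"
proof -
  have "parity_twist d (tword []) = (tword [] :: 'a tensor)"
    by (simp only: parity_twist_def linext_tword) (simp add: parity_sign_def)
  then show ?thesis by transfer (simp add: supercomm_ideal.zero)
qed

lemma ptwist_sgen: "ptwist d (sgen g) = scale (koszul d (is_odd g)) (sgen g)"
proof -
  have "parity_twist d (tword [g]) = tscalar (koszul d (is_odd g)) * tword [g]"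
    by (simp only: parity_twist_def linext_tword) (simp add: parity_sign_def)
  then show ?thesis by transfer (simp add: supercomm_ideal.zero)
qed

text \<open>Comparison on generators. Since \<open>mult\<close> asks only that equality pass from
  two factors to their product, this serves homomorphisms and superderivations alike.\<close>

lemma mult_lin_eqI:
  assumes D: "lin D" and E: "lin E"
    and mult: "\<And>a b. D a = E a \<Longrightarrow> D b = E b \<Longrightarrow> D (a * b) = E (a * b)"
    and one: "D 1 = E 1" and gen: "\<And>g. D (sgen g) = E (sgen g)"
  shows "D a = E a"
proof (rule lin_eqI[OF D E])
  show "D (mon w) = E (mon w)" for w
    by (induction w) (simp_all add: one gen mult)
qed

lemma ptwist_False [simp]: "ptwist False a = a"
  by (rule mult_lin_eqI[OF lin_ptwist lin_id]) (simp_all add: ptwist_mult ptwist_sgen koszul_def)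

lemma ptwist_ptwist: "ptwist d (ptwist e a) = ptwist (d \<noteq> e) a"
  by (rule mult_lin_eqI[OF lin_comp[OF lin_ptwist lin_ptwist] lin_ptwist])
    (auto simp: ptwist_mult ptwist_sgen lin_scale[OF lin_ptwist] koszul_def)

lemma ptwist_commute: "ptwist d (ptwist e a) = ptwist e (ptwist d a)"
  unfolding ptwist_ptwist by (rule arg_cong2[of _ _ _ _ ptwist]) auto

text \<open>The last clause expresses that \<open>D\<close> is homogeneous of parity
  \<open>d\<close>: it moves past a parity twist at the cost of a Koszul sign. The cancellation in
  \<open>sder_supercommutator\<close> rests on it.\<close>

definition sder :: "bool \<Rightarrow> ('g::superindex symalg \<Rightarrow> 'g symalg) \<Rightarrow> bool"
  where "sder d D \<longleftrightarrow> lin D \<and> (\<forall>a b. D (a * b) = D a * b + ptwist d a * D b)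
    \<and> (\<forall>e a. D (ptwist e a) = scale (koszul d e) (ptwist e (D a)))"

lemma sder_lin: "sder d D \<Longrightarrow> lin D"
  and sder_mult: "sder d D \<Longrightarrow> D (a * b) = D a * b + ptwist d a * D b"
  and sder_twist: "sder d D \<Longrightarrow> D (ptwist e a) = scale (koszul d e) (ptwist e (D a))"
  by (auto simp: sder_def)

lemma leibniz_1:
  assumes "\<And>a b. D (a * b) = D a * b + ptwist d a * D b"
  shows "D 1 = 0"
  using assms[of 1 1] by simp

lemma sder_1: "sder d D \<Longrightarrow> D 1 = 0"
  by (rule leibniz_1) (rule sder_mult)

lemma koszul_square [simp]: "koszul a b * koszul a b = 1"
  by (simp add: koszul_def)

text \<open>Homogeneity has to be checked on generators only, because the Leibniz rule carries it to
  products.\<close>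

lemma sderI:
  assumes D: "lin D" and mult: "\<And>a b. D (a * b) = D a * b + ptwist d a * D b"
    and gen: "\<And>e g. ptwist e (D (sgen g)) = scale (koszul e (d \<noteq> is_odd g)) (D (sgen g))"
  shows "sder d D"
proof -
  have "D (ptwist e a) = scale (koszul d e) (ptwist e (D a))" for e a
  proof (rule mult_lin_eqI[OF lin_comp[OF D lin_ptwist] lin_scaled[OF lin_comp[OF lin_ptwist D]]])
    show "D (ptwist e 1) = scale (koszul d e) (ptwist e (D 1))"
      by (simp add: leibniz_1[OF mult] lin_0[OF lin_ptwist])
    show "D (ptwist e (sgen g)) = scale (koszul d e) (ptwist e (D (sgen g)))" for g
      by (auto simp: ptwist_sgen lin_scale[OF D] gen koszul_def)
    fix a b
    assume IH: "D (ptwist e a) = scale (koszul d e) (ptwist e (D a))"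
      "D (ptwist e b) = scale (koszul d e) (ptwist e (D b))"
    show "D (ptwist e (a * b)) = scale (koszul d e) (ptwist e (D (a * b)))"
      by (simp add: ptwist_mult mult IH lin_add[OF lin_ptwist] scale_add_right ptwist_commute[of d e]
          scale_mult_left scale_mult_right)
  qed
  then show ?thesis using assms by (simp add: sder_def)
qed

text \<open>The mixed terms of the two Leibniz rules cancel by homogeneity. As a result, commutation
  relations between superderivations can be verified on generators.\<close>

lemma sder_supercommutator:
  assumes D: "sder d D" and E: "sder e E"
  shows "sder (d \<noteq> e) (\<lambda>a. D (E a) - scale (koszul d e) (E (D a)))"
proof -
  have l: "lin (\<lambda>a. D (E a) - scale (koszul d e) (E (D a)))"
    using D E by (intro lin_minus[OF lin_comp lin_scaled[OF lin_comp]]) (auto dest: sder_lin)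
  have m: "D (E (a * b)) - scale (koszul d e) (E (D (a * b)))
      = (D (E a) - scale (koszul d e) (E (D a))) * b
        + ptwist (d \<noteq> e) a * (D (E b) - scale (koszul d e) (E (D b)))" for a b
  proof -
    have k: "koszul e d = koszul d e" by (auto simp: koszul_def)
    have n: "ptwist e (ptwist d x) = ptwist (d \<noteq> e) x" "ptwist d (ptwist e x) = ptwist (d \<noteq> e) x" for x
      using ptwist_commute[of e d x] by (simp_all add: ptwist_ptwist)
    show ?thesis
      unfolding sder_mult[OF D] sder_mult[OF E] lin_add[OF sder_lin[OF D]] lin_add[OF sder_lin[OF E]]
        sder_twist[OF D] sder_twist[OF E] k n scale_add_right scale_mult_left scale_scale
        koszul_square scale_1 left_diff_distrib right_diff_distrib scale_mult_right
      by simp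
  qed
  have p: "D (E (ptwist f a)) - scale (koszul d e) (E (D (ptwist f a)))
    = scale (koszul (d \<noteq> e) f) (ptwist f (D (E a) - scale (koszul d e) (E (D a))))" for f a
    unfolding sder_twist[OF D] sder_twist[OF E] lin_scale[OF sder_lin[OF D]]
      lin_scale[OF sder_lin[OF E]] lin_diff[OF lin_ptwist] lin_scale[OF lin_ptwist]
      sv.scale_right_diff_distrib scale_scale
    by (auto simp: koszul_def)
  show ?thesis using l m p by (simp add: sder_def)
qed

definition multiplicative :: "('g::superindex symalg \<Rightarrow> 'g symalg) \<Rightarrow> bool"
  where "multiplicative h \<longleftrightarrow> lin h \<and> h 1 = 1 \<and> (\<forall>a b. h (a * b) = h a * h b)"

text \<open>Here \<open>D\<close> and \<open>E\<close> are superderivations along the homomorphism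
  \<open>h\<close>. Ordinary superderivations are the case of the identity; for evaluation at a
  point, \<open>h\<close> is the evaluation itself.\<close>

lemma der_over_eqI:
  assumes "lin D" "lin E" "multiplicative h"
    and "\<And>a b. D (a * b) = D a * h b + ptwist d (h a) * D b"
    and "\<And>a b. E (a * b) = E a * h b + ptwist d (h a) * E b"
    and "\<And>g. D (sgen g) = E (sgen g)"
  shows "D a = E a"
proof (rule mult_lin_eqI[OF assms(1,2)])
  have "D 1 = 0" "E 1 = 0"
    using assms(4,5)[of 1 1] assms(3) by (simp_all add: multiplicative_def)
  then show "D 1 = E 1" by simp
qed (simp_all add: assms)

lemma multiplicative_id: "multiplicative (\<lambda>a. a)"
  by (simp add: multiplicative_def lin_id)

lemma sder_eqI:
  assumes "sder d D" "sder d E" "\<And>g. D (sgen g) = E (sgen g)"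
  shows "D a = E a"
  by (rule der_over_eqI[OF _ _ multiplicative_id]) (use assms in \<open>auto simp: sder_def\<close>)

lemma sder_0: "sder d (\<lambda>a. 0)"
  by (simp add: sder_def lin_def lin_0[OF lin_ptwist])

lemma sder_commute:
  assumes D: "sder d D" and E: "sder e E"
    and "\<And>g. D (E (sgen g)) = scale (koszul d e) (E (D (sgen g)))"
  shows "D (E a) = scale (koszul d e) (E (D a))"
  using sder_eqI[OF sder_supercommutator[OF D E] sder_0, of a] assms(3) by simp

section \<open>Values of the given superderivations on generators\<close>

definition gpart :: "bool \<Rightarrow> ('g::superindex \<Rightarrow>\<^sub>0 complex) \<Rightarrow> 'g symalg"
  where "gpart e p = (\<Sum>h\<in>{h \<in> Poly_Mapping.keys p. is_odd h = e}. scale (Poly_Mapping.lookup p h) (sgen h))"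

lemma gpart_superset:
  assumes "finite A" "Poly_Mapping.keys p \<subseteq> A"
  shows "gpart e p = (\<Sum>h\<in>A. if is_odd h = e then scale (Poly_Mapping.lookup p h) (sgen h) else 0)"
proof -
  have "gpart e p = (\<Sum>h\<in>Poly_Mapping.keys p. if is_odd h = e then scale (Poly_Mapping.lookup p h) (sgen h) else 0)"
    unfolding gpart_def by (simp add: sum.inter_filter)
  also have "\<dots> = (\<Sum>h\<in>A. if is_odd h = e then scale (Poly_Mapping.lookup p h) (sgen h) else 0)"
    using assms by (intro sum.mono_neutral_left) (auto simp: in_keys_iff)
  finally show ?thesis .
qed

lemma gpart_0 [simp]: "gpart e 0 = 0"
  by (simp add: gpart_def)

lemma gpart_add: "gpart e (p + q) = gpart e p + gpart e q"
proof -
  let ?A = "Poly_Mapping.keys p \<union> Poly_Mapping.keys q"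
  have "Poly_Mapping.keys (p + q) \<subseteq> ?A" by (rule keys_add)
  then show ?thesis
    by (auto simp: gpart_superset[of ?A] lookup_add scale_add_left sum.distrib[symmetric]
        intro!: sum.cong)
qed

lemma gpart_sum: "gpart e (sum f A) = (\<Sum>x\<in>A. gpart e (f x))"
  by (induction A rule: infinite_finite_induct) (simp_all add: gpart_add)

lemma gpart_single:
  "gpart e (Poly_Mapping.single h c) = (if is_odd h = e then scale c (sgen h) else 0)"
  by (simp add: gpart_superset[of "{h}"])

lemma ptwist_gpart: "ptwist d (gpart e p) = scale (koszul d e) (gpart e p)"
  by (simp add: gpart_def lin_sum[OF lin_ptwist] lin_scale[OF lin_ptwist] ptwist_sgen
      sv.scale_sum_right mult.commute)

lemma abs_symalg_sum: "abs_symalg (sum f A) = (\<Sum>x\<in>A. abs_symalg (f x))"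
  by (induction A rule: infinite_finite_induct)
    (simp_all add: zero_symalg.abs_eq[symmetric] plus_symalg.abs_eq[symmetric])

lemma hom_superder_sgen: "hom_superder d \<phi> (sgen g) = gpart (is_odd g \<noteq> d) (\<phi> g)"
proof -
  have "hom_superder d \<phi> (sgen g) = abs_symalg (der_word d \<phi> [g])"
    unfolding sgen.abs_eq hom_superder.abs_eq tensor_der_def linext_tword ..
  then show ?thesis
    by (simp add: abs_symalg_sum gpart_def sgen.abs_eq scale.abs_eq)
qed

lemma sder_hom_superder: "sder d (hom_superder d \<phi>)"
proof (rule sderI)
  show "lin (hom_superder d \<phi>)"
  proof (rule linI)
    show "hom_superder d \<phi> (a + b) = hom_superder d \<phi> a + hom_superder d \<phi> b" for a b
      by transfer (simp add: tensor_der_def linext_add supercomm_ideal.zero)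
    show "hom_superder d \<phi> (scale c a) = scale c (hom_superder d \<phi> a)" for a c
      by transfer (simp add: tensor_der_def linext_scal supercomm_ideal.zero)
  qed
  show "hom_superder d \<phi> (a * b) = hom_superder d \<phi> a * b + ptwist d a * hom_superder d \<phi> b" for a b
    by transfer (simp add: tensor_der_mult supercomm_ideal.zero)
  show "ptwist e (hom_superder d \<phi> (sgen g)) = scale (koszul e (d \<noteq> is_odd g)) (hom_superder d \<phi> (sgen g))"
    for e g
    by (auto simp: hom_superder_sgen ptwist_gpart koszul_def)
qed

section \<open>Left partial derivatives\<close>

fun pd_word :: "'g::superindex \<Rightarrow> 'g list \<Rightarrow> 'g symalg" where
  "pd_word x [] = 0"
| "pd_word x (g # w) = (if g = x then mon w else 0)
    + scale (koszul (is_odd x) (is_odd g)) (sgen g * pd_word x w)"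

text \<open>A partial derivative sends generators to constants instead of linear combinations of
  generators, so it is not of the form \<open>hom_superder\<close> and is built from words.\<close>

definition pd :: "'g::superindex \<Rightarrow> 'g symalg \<Rightarrow> 'g symalg"
  where "pd x = ext (pd_word x)"

lemma mon_swap: "mon (u @ g # h # v) = scale (koszul (is_odd g) (is_odd h)) (mon (u @ h # g # v))"
  by (simp add: mon_append scale_mult_right scale_mult_left mult.assoc[symmetric] sgen_commute[of g])

lemma swap_inv_pd: "swap_inv (pd_word x)"
proof -
  have "pd_word x (u @ g # h # v) = scale (koszul (is_odd g) (is_odd h)) (pd_word x (u @ h # g # v))"
    for u g h v
  proof (induction u)
    case Nil
    have c: "sgen g * (sgen h * z) = scale (koszul (is_odd g) (is_odd h)) (sgen h * (sgen g * z))" for z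
      using sgen_commute[of g h] by (simp add: mult.assoc[symmetric] scale_mult_left)
    show ?case
      by (simp add: c scale_add_right distrib_left scale_mult_right) (auto simp: koszul_def)
  next
    case (Cons a u)
    then show ?case
      by (simp add: mon_swap[of u g h] scale_add_right scale_mult_right mult.commute)
  qed
  then show ?thesis unfolding swap_inv_def append_Cons append_Nil by blast
qed

lemma lin_pd: "lin (pd x)"
  by (simp add: pd_def lin_ext swap_inv_pd)

lemma pd_mon_Cons: "pd x (sgen g * mon w) = (if g = x then mon w else 0)
    + scale (koszul (is_odd x) (is_odd g)) (sgen g * pd x (mon w))"
  using ext_mon[OF swap_inv_pd, of x "g # w"] ext_mon[OF swap_inv_pd, of x w]
  by (simp add: pd_def)

lemma pd_1 [simp]: "pd x 1 = 0"
  using ext_mon[OF swap_inv_pd, of x "[]"] by (simp add: pd_def)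

lemma pd_sgen_mult: "pd x (sgen g * a) = (if g = x then a else 0)
    + scale (koszul (is_odd x) (is_odd g)) (sgen g * pd x a)"
proof -
  have "lin (\<lambda>a. pd x (sgen g * a))" "lin (\<lambda>a. (if g = x then a else 0)
    + scale (koszul (is_odd x) (is_odd g)) (sgen g * pd x a))"
    by (rule lin_comp[OF lin_pd lin_multL])
      (rule lin_plus[OF _ lin_scaled[OF lin_comp[OF lin_multL lin_pd]]], simp add: lin_def)
  then show ?thesis by (rule lin_eqI) (rule pd_mon_Cons)
qed

lemma pd_sgen: "pd x (sgen g) = (if g = x then 1 else 0)"
  using pd_sgen_mult[of x g 1] by simp

lemma sder_pd: "sder (is_odd x) (pd x)"
proof (rule sderI[OF lin_pd])
  fix a b :: "'a symalg"
  have "lin (\<lambda>a. pd x (a * b))" "lin (\<lambda>a. pd x a * b + ptwist (is_odd x) a * pd x b)"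
    by (intro lin_comp[OF lin_pd lin_multR] lin_plus lin_comp[OF lin_multR lin_pd]
        lin_comp[OF lin_multR lin_ptwist])+
  then show "pd x (a * b) = pd x a * b + ptwist (is_odd x) a * pd x b"
  proof (rule lin_eqI)
    show "pd x (mon w * b) = pd x (mon w) * b + ptwist (is_odd x) (mon w) * pd x b" for w
    proof (induction w)
      case (Cons g w)
      then show ?case
        by (simp add: mult.assoc pd_sgen_mult[of x g] ptwist_mult ptwist_sgen scale_mult_left
            distrib_left distrib_right scale_add_right)
    qed simp
  qed
next
  show "ptwist e (pd x (sgen g)) = scale (koszul e (is_odd x \<noteq> is_odd g)) (pd x (sgen g))" for e g
    by (auto simp: pd_sgen koszul_def lin_0[OF lin_ptwist])
qed

section \<open>Homomorphisms prescribed on generators\<close>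

definition shom :: "('g::superindex \<Rightarrow> 'g symalg) \<Rightarrow> 'g symalg \<Rightarrow> 'g symalg"
  where "shom \<psi> = ext (\<lambda>w. prod_list (map \<psi> w))"

text \<open>The universal property of the symmetric superalgebra: the images have to satisfy the
  defining relations.\<close>

lemma shom:
  assumes "\<And>g h. \<psi> g * \<psi> h = scale (koszul (is_odd g) (is_odd h)) (\<psi> h * \<psi> g)"
  shows "multiplicative (shom \<psi>)" "shom \<psi> (sgen g) = \<psi> g"
proof -
  have s: "swap_inv (\<lambda>w. prod_list (map \<psi> w))"
    unfolding swap_inv_def
  proof (intro allI)
    fix u g h v
    show "prod_list (map \<psi> (u @ [g, h] @ v))
      = scale (koszul (is_odd g) (is_odd h)) (prod_list (map \<psi> (u @ [h, g] @ v)))"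
    proof -
      have "\<psi> g * (\<psi> h * z) = scale (koszul (is_odd g) (is_odd h)) (\<psi> h * (\<psi> g * z))" for z
        by (simp only: mult.assoc[symmetric] assms[of g h] scale_mult_left)
      then show ?thesis by (simp only: map_append prod_list.append list.map prod_list.Cons scale_mult_right append.simps)
    qed
  qed
  have m: "shom \<psi> (mon w) = prod_list (map \<psi> w)" for w
    by (simp add: shom_def ext_mon[OF s])
  have l: "lin (shom \<psi>)" by (simp add: shom_def lin_ext s)
  have "shom \<psi> (mon u * b) = shom \<psi> (mon u) * shom \<psi> b" for u b
    by (rule lin_eqI[OF lin_comp[OF l lin_multL] lin_comp[OF lin_multL l]])
      (simp add: m flip: mon_append)
  then have "shom \<psi> (a * b) = shom \<psi> a * shom \<psi> b" for a b
    using lin_eqI[OF lin_comp[OF l lin_multR] lin_comp[OF lin_multR l], of b "shom \<psi> b" a] by blast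
  then show "multiplicative (shom \<psi>)" using l m[of "[]"] by (simp add: multiplicative_def)
  show "shom \<psi> (sgen g) = \<psi> g" using m[of "[g]"] by simp
qed

section \<open>The actions of the general linear Lie superalgebras\<close>

text \<open>The Leibniz rule alters one factor at a time. The factors are arbitrary eigenvectors of
  the parity twist, so that the lemma covers monomials as well as products of scalar
  products.\<close>

lemma der_prod:
  assumes D: "sder d D" and tw: "\<And>x. x \<in> set w \<Longrightarrow> \<exists>c. ptwist d (f x) = scale c (f x)"
    and R: "\<And>x. x \<in> set w \<Longrightarrow> D (f x) \<in> sv.span (f ` R x)"
  shows "D (prod_list (map f w))
    \<in> sv.span {prod_list (map f (u @ y # v)) | u x y v. w = u @ x # v \<and> y \<in> R x}"
    (is "_ \<in> sv.span (?S w)")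
  using tw R
proof (induction w)
  case Nil
  then show ?case by (simp add: sder_1[OF D] sv.span_zero)
next
  case (Cons x w)
  obtain c where c: "ptwist d (f x) = scale c (f x)" using Cons.prems(1)[of x] by auto
  have "D (f x) * prod_list (map f w) \<in> sv.span (?S (x # w))"
  proof (rule lin_span[OF lin_multR, of _ "f ` R x"])
    show "D (f x) \<in> sv.span (f ` R x)" using Cons.prems(2)[of x] by simp
    fix z assume "z \<in> f ` R x"
    then obtain y where y: "z = f y" "y \<in> R x" by blast
    have "z * prod_list (map f w) = prod_list (map f ([] @ y # w))" by (simp add: y)
    with y show "z * prod_list (map f w) \<in> sv.span (?S (x # w))"
      by (intro sv.span_base) blast
  qed
  moreover have "f x * D (prod_list (map f w)) \<in> sv.span (?S (x # w))"
  proof (rule lin_span[OF lin_multL, of _ "?S w"])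
    show "D (prod_list (map f w)) \<in> sv.span (?S w)"
      using Cons.prems by (intro Cons.IH) auto
    fix z assume "z \<in> ?S w"
    then obtain u x' y v where z: "z = prod_list (map f (u @ y # v))" "w = u @ x' # v" "y \<in> R x'"
      by blast
    have "f x * z = prod_list (map f ((x # u) @ y # v))" "x # w = (x # u) @ x' # v"
      by (simp_all add: z)
    with z(3) show "f x * z \<in> sv.span (?S (x # w))"
      by (intro sv.span_base) blast
  qed
  ultimately show ?case
    by (simp add: sder_mult[OF D] c scale_mult_left sv.span_add sv.span_scale)
qed

lemma ptwist_sgen_ex: "\<exists>c. ptwist d (sgen x) = scale c (sgen x)"
  using ptwist_sgen by blast

lemmas der_mon = der_prod[where f = sgen, OF _ ptwist_sgen_ex, folded mon_def]

section \<open>Spanning words of the mixed algebra\<close>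

definition gset :: "idx set \<Rightarrow> idx set \<Rightarrow> idx set \<Rightarrow> gen set"
  where "gset T S I = {X t i | t i. t \<in> T \<and> i \<in> I} \<union> {Xd i s | i s. i \<in> I \<and> s \<in> S}"

lemma gset_iff [simp]: "X t i \<in> gset T S I \<longleftrightarrow> t \<in> T \<and> i \<in> I" "Xd i s \<in> gset T S I \<longleftrightarrow> i \<in> I \<and> s \<in> S"
  by (auto simp: gset_def)

lemma finite_gset: "finite T \<Longrightarrow> finite S \<Longrightarrow> finite I \<Longrightarrow> finite (gset T S I)"
  unfolding gset_def by (intro finite_UnI finite_image_set2) auto

lemma span_mult:
  assumes "a \<in> sv.span A" "b \<in> sv.span B" "\<And>x y. x \<in> A \<Longrightarrow> y \<in> B \<Longrightarrow> x * y \<in> sv.span C"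
  shows "a * b \<in> sv.span C"
  by (rule lin_span[OF lin_multR assms(1)], rule lin_span[OF lin_multL assms(2)]) (rule assms(3))

lemma subalgebra_subspace:
  assumes "is_subalgebra B"
  shows "sv.subspace B"
proof -
  have "scale 0 1 \<in> B" using assms unfolding is_subalgebra_def by blast
  then show ?thesis using assms by (simp add: is_subalgebra_def sv.subspace_def)
qed

lemma subalgebra_prod_list:
  "is_subalgebra B \<Longrightarrow> (\<And>x. x \<in> set w \<Longrightarrow> f x \<in> B) \<Longrightarrow> prod_list (map f w) \<in> B"
  by (induction w) (auto simp: is_subalgebra_def)

text \<open>Replaces the hull by a span, so that membership can be treated by linear
  arguments.\<close>

lemma mixed_algebra_eq: "mixed_algebra T S I = sv.span (mon ` {w. set w \<subseteq> gset T S I})"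
proof
  let ?M = "sv.span (mon ` {w. set w \<subseteq> gset T S I})"
  have gens: "{sgen (X t i) | t i. t \<in> T \<and> i \<in> I} \<union> {sgen (Xd i s) | i s. i \<in> I \<and> s \<in> S}
    = sgen ` gset T S I" unfolding gset_def by blast
  have "is_subalgebra ?M"
    unfolding is_subalgebra_def
  proof (intro conjI ballI allI)
    show "1 \<in> ?M" by (rule sv.span_base) (auto intro!: image_eqI[of _ _ "[]"])
    show "a + b \<in> ?M" if "a \<in> ?M" "b \<in> ?M" for a b using that by (rule sv.span_add)
    show "a * b \<in> ?M" if "a \<in> ?M" "b \<in> ?M" for a b
      using that
      by (rule span_mult) (auto intro!: sv.span_base image_eqI simp flip: mon_append)
    show "scale c a \<in> ?M" if "a \<in> ?M" for c a using that by (rule sv.span_scale)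
  qed
  moreover have "sgen ` gset T S I \<subseteq> ?M"
  proof
    fix z assume "z \<in> sgen ` gset T S I"
    then obtain g where g: "g \<in> gset T S I" and z: "z = mon [g]" by auto
    show "z \<in> ?M" unfolding z using g by (intro sv.span_base imageI) simp
  qed
  ultimately show "mixed_algebra T S I \<subseteq> ?M"
    unfolding mixed_algebra_def gens by (intro hull_minimal)
  show "?M \<subseteq> mixed_algebra T S I"
    unfolding mixed_algebra_def gens hull_def
  proof (rule Inter_greatest, clarify)
    fix B a assume B: "is_subalgebra B" "sgen ` gset T S I \<subseteq> B" and a: "a \<in> ?M"
    have "mon ` {w. set w \<subseteq> gset T S I} \<subseteq> B"
      using B unfolding mon_def by (auto intro!: subalgebra_prod_list)
    then show "a \<in> B"
      using a sv.span_minimal subalgebra_subspace[OF B(1)] by blast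
  qed
qed

lemma mixed_subalgebra: "is_subalgebra (mixed_algebra T S I)"
  unfolding mixed_algebra_def
  by (rule hull_in) (force simp: is_subalgebra_def)

lemma sder_mixed:
  assumes D: "sder d D" and g: "\<And>g. g \<in> gset T S I \<Longrightarrow> D (sgen g) \<in> sv.span (sgen ` gset T S I)"
    and a: "a \<in> mixed_algebra T S I"
  shows "D a \<in> mixed_algebra T S I"
  using a unfolding mixed_algebra_eq
proof (rule lin_span[OF sder_lin[OF D]])
  fix z assume "z \<in> mon ` {w. set w \<subseteq> gset T S I}"
  then obtain w where w: "z = mon w" "set w \<subseteq> gset T S I" by blast
  have "D (mon w) \<in> sv.span {mon (u @ y # v) | u x y v. w = u @ x # v \<and> y \<in> gset T S I}"
    using w by (intro der_mon[OF D] g) auto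
  also have "\<dots> \<subseteq> sv.span (mon ` {w. set w \<subseteq> gset T S I})"
    using w by (intro sv.span_mono) auto
  finally show "D z \<in> sv.span (mon ` {w. set w \<subseteq> gset T S I})" by (simp add: w)
qed

section \<open>The three actions on generators and their commutation\<close>

abbreviation "derV d I A \<equiv> hom_superder d (gl_V_gen I A)"
abbreviation "derU d T A \<equiv> hom_superder d (gl_U_gen T A)"
abbreviation "derW d S A \<equiv> hom_superder d (gl_W_gen S A)"

lemma if_scale: "(if P then scale c a else 0) = scale (if P then c else 0) a"
  by simp

lemma derV_X: "derV d I A (sgen (X t i)) = (\<Sum>j\<in>I.
    scale (if (is_odd j \<noteq> is_odd i) = d then koszul d (is_odd t) * A j i else 0) (sgen (X t j)))"
  unfolding hom_superder_sgen gl_V_gen.simps gpart_sum gpart_single if_scale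
  by (intro sum.cong refl arg_cong2[of _ _ _ _ scale]) auto

lemma derV_Xd: "derV d I A (sgen (Xd i s)) = (\<Sum>j\<in>I.
    scale (if (is_odd i \<noteq> is_odd j) = d then - koszul d (is_odd i) * A i j else 0) (sgen (Xd j s)))"
  unfolding hom_superder_sgen gl_V_gen.simps gpart_sum gpart_single if_scale
  by (intro sum.cong refl arg_cong2[of _ _ _ _ scale]) auto

lemma derU_X: "derU d T A (sgen (X t i)) = (\<Sum>r\<in>T.
    scale (if (is_odd r \<noteq> is_odd t) = d then A r t else 0) (sgen (X r i)))"
  unfolding hom_superder_sgen gl_U_gen.simps gpart_sum gpart_single if_scale
  by (intro sum.cong refl arg_cong2[of _ _ _ _ scale]) auto

lemma derU_Xd: "derU d T A (sgen (Xd i s)) = 0"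
  by (simp add: hom_superder_sgen)

lemma derW_Xd: "derW d S A (sgen (Xd i s)) = (\<Sum>r\<in>S.
    scale (if (is_odd r \<noteq> is_odd s) = d then koszul d (is_odd i) * A r s else 0) (sgen (Xd i r)))"
  unfolding hom_superder_sgen gl_W_gen.simps gpart_sum gpart_single if_scale
  by (intro sum.cong refl arg_cong2[of _ _ _ _ scale]) auto

lemma derW_X: "derW d S A (sgen (X t i)) = 0"
  by (simp add: hom_superder_sgen)

lemmas lin_hom_superder = sder_lin[OF sder_hom_superder]

text \<open>On a generator the two matrices act on different indices, hence both orders give the
  same double sum up to the Koszul sign.\<close>

lemma derV_derU: "derV d I A (derU e T B a) = scale (koszul d e) (derU e T B (derV d I A a))"
proof (rule sder_commute[OF sder_hom_superder sder_hom_superder])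
  fix g
  show "derV d I A (derU e T B (sgen g)) = scale (koszul d e) (derU e T B (derV d I A (sgen g)))"
  proof (cases g)
    case (X t i)
    show ?thesis
      unfolding X derU_X derV_X lin_sum[OF lin_hom_superder] lin_scale[OF lin_hom_superder]
        sv.scale_sum_right scale_scale
      by (subst sum.swap, intro sum.cong refl arg_cong2[of _ _ _ _ scale]) (auto simp: koszul_def)
  next
    case (Xd i s)
    then show ?thesis
      by (simp add: derU_Xd derV_Xd lin_sum[OF lin_hom_superder] lin_scale[OF lin_hom_superder]
          lin_0[OF lin_hom_superder])
  qed
qed

lemma derV_derW: "derV d I A (derW e S B a) = scale (koszul d e) (derW e S B (derV d I A a))"
proof (rule sder_commute[OF sder_hom_superder sder_hom_superder])
  fix g
  show "derV d I A (derW e S B (sgen g)) = scale (koszul d e) (derW e S B (derV d I A (sgen g)))"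
  proof (cases g)
    case (Xd i s)
    show ?thesis
      unfolding Xd derW_Xd derV_Xd lin_sum[OF lin_hom_superder] lin_scale[OF lin_hom_superder]
        sv.scale_sum_right scale_scale
      by (subst sum.swap, intro sum.cong refl arg_cong2[of _ _ _ _ scale]) (auto simp: koszul_def)
  next
    case (X i s)
    then show ?thesis
      by (simp add: derW_X derV_X lin_sum[OF lin_hom_superder] lin_scale[OF lin_hom_superder]
          lin_0[OF lin_hom_superder])
  qed
qed

text \<open>The action on \<open>V\<^sup>*\<close> is minus the supertranspose: the two double sums
  from the Leibniz rule become opposite once the summation indices of one are exchanged.\<close>

lemma derV_scalar_product: "derV d I A (scalar_product I t s) = 0"
proof -
  let ?c = "\<lambda>i j. if (is_odd j \<noteq> is_odd i) = d then koszul d (is_odd t) * A j i else 0"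
  have "derV d I A (scalar_product I t s)
    = (\<Sum>i\<in>I. \<Sum>j\<in>I. scale (?c i j) (sgen (X t j) * sgen (Xd i s)))
      + (\<Sum>i\<in>I. \<Sum>j\<in>I. scale (- ?c j i) (sgen (X t i) * sgen (Xd j s)))"
    unfolding scalar_product_def lin_sum[OF lin_hom_superder] sder_mult[OF sder_hom_superder]
      derV_X derV_Xd sum_distrib_left sum_distrib_right scale_mult_left scale_mult_right ptwist_sgen
      scale_scale sum.distrib
    by (intro arg_cong2[of _ _ _ _ "(+)"] refl sum.cong arg_cong2[of _ _ _ _ scale])
      (auto simp: koszul_def)
  also have "(\<Sum>i\<in>I. \<Sum>j\<in>I. scale (- ?c j i) (sgen (X t i) * sgen (Xd j s)))
    = - (\<Sum>i\<in>I. \<Sum>j\<in>I. scale (?c i j) (sgen (X t j) * sgen (Xd i s)))"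
    by (subst sum.swap) (simp add: sum_negf)
  finally show ?thesis by simp
qed

lemma derV_sgen_span:
  "derV d I A (sgen g) \<in> sv.span (sgen ` (case g of X t i \<Rightarrow> X t ` I | Xd i s \<Rightarrow> (\<lambda>j. Xd j s) ` I))"
proof (cases g)
  case (X t i)
  show ?thesis unfolding X derV_X gen.case
    by (intro sv.span_sum sv.span_scale sv.span_base imageI)
next
  case (Xd i s)
  show ?thesis unfolding Xd derV_Xd gen.case
    by (intro sv.span_sum sv.span_scale sv.span_base imageI)
qed

lemma derU_sgen_span:
  "derU d T A (sgen g) \<in> sv.span (sgen ` (case g of X t i \<Rightarrow> (\<lambda>r. X r i) ` T | Xd i s \<Rightarrow> {}))"
proof (cases g)
  case (X t i)
  show ?thesis unfolding X derU_X gen.case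
    by (intro sv.span_sum sv.span_scale sv.span_base imageI)
qed (simp add: derU_Xd sv.span_zero)

lemma derW_sgen_span:
  "derW d S A (sgen g) \<in> sv.span (sgen ` (case g of X t i \<Rightarrow> {} | Xd i s \<Rightarrow> Xd i ` S))"
proof (cases g)
  case (Xd i s)
  show ?thesis unfolding Xd derW_Xd gen.case
    by (intro sv.span_sum sv.span_scale sv.span_base imageI)
qed (simp add: derW_X sv.span_zero)

lemma invariants_iff:
  "a \<in> invariants T S I (gl I) \<longleftrightarrow> a \<in> mixed_algebra T S I \<and> (\<forall>d. \<forall>A\<in>gl I. derV d I A a = 0)"
proof -
  have "derV d I A a = 0" if inv: "\<forall>A\<in>gl I. superder (gl_V_gen I A) a = 0" and A: "A \<in> gl I" for d A
  proof -
    \<comment> \<open>Invariance only controls the sum of the even and the odd operator of a matrix.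
      The part of \<open>A\<close> of parity \<open>d\<close> has the same operator as
      \<open>A\<close> in parity \<open>d\<close> and operator 0 in the other parity.\<close>
    define B where "B = (\<lambda>i j. if (is_odd i \<noteq> is_odd j) = d then A i j else 0)"
    have "B \<in> gl I" using A by (auto simp: gl_def B_def)
    then have "superder (gl_V_gen I B) a = 0" using inv by blast
    moreover have "derV d I B a = derV d I A a"
    proof (rule sder_eqI[OF sder_hom_superder sder_hom_superder])
      show "derV d I B (sgen g) = derV d I A (sgen g)" for g
        by (cases g) (auto simp: derV_X derV_Xd B_def intro!: sum.cong)
    qed
    moreover have "derV (\<not> d) I B a = 0"
    proof (rule sder_eqI[OF sder_hom_superder sder_0])
      show "derV (\<not> d) I B (sgen g) = 0" for g
        by (cases g) (auto simp: derV_X derV_Xd B_def intro!: sum.neutral)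
    qed
    ultimately show ?thesis by (cases d) (simp_all add: superder_def)
  qed
  then show ?thesis by (auto simp: invariants_def superder_def)
qed

section \<open>The invariants as a polarization stable subalgebra\<close>

lemma invariants_subalgebra: "is_subalgebra (invariants T S I (gl I))"
  using mixed_subalgebra[of T S I]
  by (simp add: is_subalgebra_def invariants_iff sder_1[OF sder_hom_superder]
      lin_add[OF lin_hom_superder] lin_scale[OF lin_hom_superder] sder_mult[OF sder_hom_superder])

lemma subalgebra_superder:
  assumes "is_subalgebra B" "\<And>d. hom_superder d \<phi> a \<in> B"
  shows "superder \<phi> a \<in> B"
  using assms by (simp add: superder_def is_subalgebra_def)

lemma invariants_polarization_stable: "polarization_stable T S (invariants T S I (gl I))"
  (is "polarization_stable T S ?Inv")
proof -
  have U: "derU d T A a \<in> ?Inv" if "a \<in> ?Inv" for d A a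
  proof -
    have "derU d T A (sgen g) \<in> sv.span (sgen ` gset T S I)" if "g \<in> gset T S I" for g
      using that by (intro set_mp[OF sv.span_mono derU_sgen_span]) (auto split: gen.splits)
    then show ?thesis
      using that by (simp add: invariants_iff derV_derU lin_0[OF lin_hom_superder]
          sder_mixed[OF sder_hom_superder])
  qed
  have W: "derW d S A a \<in> ?Inv" if "a \<in> ?Inv" for d A a
  proof -
    have "derW d S A (sgen g) \<in> sv.span (sgen ` gset T S I)" if "g \<in> gset T S I" for g
      using that by (intro set_mp[OF sv.span_mono derW_sgen_span]) (auto split: gen.splits)
    then show ?thesis
      using that by (simp add: invariants_iff derV_derW lin_0[OF lin_hom_superder]
          sder_mixed[OF sder_hom_superder])
  qed
  have "P a \<in> ?Inv" if "P \<in> polarization_ops T S" "a \<in> ?Inv" for P a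
    using that
  proof (induction arbitrary: a)
    case (gl_U A)
    then show ?case by (intro subalgebra_superder invariants_subalgebra U)
  next
    case (gl_W A)
    then show ?case by (intro subalgebra_superder invariants_subalgebra W)
  next
    case (add P Q)
    then show ?case using invariants_subalgebra by (simp add: is_subalgebra_def)
  next
    case (scale P c)
    then show ?case using invariants_subalgebra by (simp add: is_subalgebra_def)
  qed simp_all
  then show ?thesis by (auto simp: polarization_stable_def)
qed

lemma scalar_product_invariant:
  assumes "t \<in> T" "s \<in> S"
  shows "scalar_product I t s \<in> invariants T S I (gl I)"
proof -
  have "mon [X t i, Xd i s] \<in> mixed_algebra T S I" if "i \<in> I" for i
    unfolding mixed_algebra_eq using that assms by (intro sv.span_base imageI) simp
  then have "sgen (X t i) * sgen (Xd i s) \<in> mixed_algebra T S I" if "i \<in> I" for i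
    using that by simp
  then have "scalar_product I t s \<in> mixed_algebra T S I"
    unfolding scalar_product_def mixed_algebra_eq by (intro sv.span_sum)
  then show ?thesis by (simp add: invariants_iff derV_scalar_product)
qed

text \<open>The invariants are a polarization stable subalgebra containing \<open>M\<close>, which
  gives one inclusion; conversely every subalgebra containing \<open>M\<close> contains the span of
  the products of its elements.\<close>

lemma basic_setI:
  assumes M: "M \<subseteq> invariants T S I (gl I)"
    and inv: "\<And>a. a \<in> invariants T S I (gl I) \<Longrightarrow> a \<in> sv.span (prod_list ` lists M)"
  shows "basic_set T S I (gl I) M"
proof -
  let ?Q = "\<lambda>B. B \<subseteq> mixed_algebra T S I \<and> is_subalgebra B \<and> polarization_stable T S B"
  have "?Q (invariants T S I (gl I))"
    using invariants_subalgebra invariants_polarization_stable by (auto simp: invariants_def)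
  then have "?Q hull M \<subseteq> invariants T S I (gl I)"
    by (intro hull_minimal M)
  moreover have "invariants T S I (gl I) \<subseteq> ?Q hull M"
    unfolding hull_def
  proof (rule Inter_greatest, rule subsetI)
    fix B a
    assume "B \<in> {B. ?Q B \<and> M \<subseteq> B}" and a: "a \<in> invariants T S I (gl I)"
    then have B: "M \<subseteq> B" "is_subalgebra B" by auto
    have "prod_list ` lists M \<subseteq> B"
    proof (rule image_subsetI)
      fix w assume "w \<in> lists M"
      then show "prod_list w \<in> B" using subalgebra_prod_list[OF B(2), of w "\<lambda>x. x"] B(1) by auto
    qed
    then show "a \<in> B"
      using inv[OF a] sv.span_minimal subalgebra_subspace[OF B(2)] by blast
  qed
  ultimately show ?thesis using M by (simp add: basic_set_def)
qed

section \<open>Bidegrees\<close>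

definition count_in :: "'a set \<Rightarrow> 'a list \<Rightarrow> nat"
  where "count_in Q w = length (filter (\<lambda>x. x \<in> Q) w)"

lemma count_in_simps [simp]: "count_in Q [] = 0" "count_in Q (x # w) = (if x \<in> Q then Suc (count_in Q w) else count_in Q w)"
  "count_in Q (u @ v) = count_in Q u + count_in Q v"
  by (simp_all add: count_in_def)

definition bideg :: "gen list \<Rightarrow> nat \<times> nat"
  where "bideg w = (count_in (range (case_prod X)) w, count_in (range (case_prod Xd)) w)"

lemma X_range [simp]: "X t i \<in> range (case_prod X)" "X t i \<notin> range (case_prod Xd)"
  "Xd i s \<in> range (case_prod Xd)" "Xd i s \<notin> range (case_prod X)"
  by (auto intro: rev_image_eqI)

definition bicomp :: "nat \<times> nat \<Rightarrow> gen symalg \<Rightarrow> gen symalg"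
  where "bicomp c = ext (\<lambda>w. if bideg w = c then mon w else 0)"

lemma swap_inv_bicomp: "swap_inv (\<lambda>w. if bideg w = c then mon w else 0)"
  unfolding swap_inv_def
proof (intro allI)
  fix u v and g h :: gen
  have "bideg (u @ [h, g] @ v) = bideg (u @ [g, h] @ v)" by (simp add: bideg_def)
  then show "(if bideg (u @ [g, h] @ v) = c then mon (u @ [g, h] @ v) else 0)
    = scale (koszul (is_odd g) (is_odd h))
        (if bideg (u @ [h, g] @ v) = c then mon (u @ [h, g] @ v) else 0)"
    using mon_swap[of u g h v] by simp
qed

lemma lin_bicomp: "lin (bicomp c)"
  by (simp add: bicomp_def lin_ext swap_inv_bicomp)

lemma bicomp_mon: "bicomp c (mon w) = (if bideg w = c then mon w else 0)"
  by (simp add: bicomp_def ext_mon swap_inv_bicomp)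

lemma bicomp_decomposition: "\<exists>K. finite K \<and> a = (\<Sum>c\<in>K. bicomp c a)"
proof -
  \<comment> \<open>The claim for all finite supersets of \<open>K\<close> lets the induction add a
    further monomial, whose bidegree may lie outside the set found so far.\<close>
  have "\<exists>K. finite K \<and> (\<forall>K'. K \<subseteq> K' \<longrightarrow> finite K' \<longrightarrow> a = (\<Sum>c\<in>K'. bicomp c a))"
    using span_mon[of a]
  proof (induction rule: sv.span_induct_alt)
    case base
    then show ?case by (auto simp: lin_0[OF lin_bicomp])
  next
    case (step k x y)
    then obtain K where K: "finite K" "\<And>K'. K \<subseteq> K' \<Longrightarrow> finite K' \<Longrightarrow> y = (\<Sum>c\<in>K'. bicomp c y)"
      by blast
    from step obtain w where w: "x = mon w" by blast
    have "scale k x + y = (\<Sum>c\<in>K'. bicomp c (scale k x + y))" if "insert (bideg w) K \<subseteq> K'" "finite K'" for K'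
    proof -
      have "(\<Sum>c\<in>K'. bicomp c x) = x" using that by (simp add: w bicomp_mon)
      moreover have "(\<Sum>c\<in>K'. bicomp c y) = y" using K(2)[of K'] that by simp
      ultimately show ?thesis
        by (simp add: lin_add[OF lin_bicomp] lin_scale[OF lin_bicomp] sum.distrib
            flip: sv.scale_sum_right)
    qed
    then show ?case using K(1) by (intro exI[of _ "insert (bideg w) K"]) simp
  qed
  then show ?thesis by blast
qed

lemma bicomp_mixed:
  assumes "a \<in> mixed_algebra T S I"
  shows "bicomp c a \<in> sv.span (mon ` {w. set w \<subseteq> gset T S I \<and> bideg w = c})"
  using assms unfolding mixed_algebra_eq
proof (rule lin_span[OF lin_bicomp])
  fix z assume "z \<in> mon ` {w. set w \<subseteq> gset T S I}"
  then obtain w where "z = mon w" "set w \<subseteq> gset T S I" by blast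
  then show "bicomp c z \<in> sv.span (mon ` {w. set w \<subseteq> gset T S I \<and> bideg w = c})"
    by (cases "bideg w = c") (auto simp: bicomp_mon sv.span_zero intro: sv.span_base)
qed

lemma derV_mon_bideg: "derV d I A (mon w) \<in> sv.span (mon ` {v. bideg v = bideg w})"
proof (rule set_mp[OF sv.span_mono der_mon[OF sder_hom_superder derV_sgen_span]])
  show "{mon (u @ y # v) |u x y v. w = u @ x # v
      \<and> y \<in> (case x of X t i \<Rightarrow> X t ` I | Xd i s \<Rightarrow> (\<lambda>j. Xd j s) ` I)}
    \<subseteq> mon ` {v. bideg v = bideg w}"
  proof clarify
    fix u x y v
    assume "y \<in> (case x of X t i \<Rightarrow> X t ` I | Xd i s \<Rightarrow> (\<lambda>j. Xd j s) ` I)"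
    then have "bideg (u @ y # v) = bideg (u @ x # v)"
      by (cases x) (auto simp: bideg_def)
    then show "mon (u @ y # v) \<in> mon ` {w. bideg w = bideg (u @ x # v)}"
      by (intro imageI CollectI)
  qed
qed

lemma derV_bicomp: "derV d I A (bicomp c a) = bicomp c (derV d I A a)"
proof (rule lin_eqI[OF lin_comp[OF lin_hom_superder lin_bicomp]
      lin_comp[OF lin_bicomp lin_hom_superder]])
  fix w
  have "bicomp c (derV d I A (mon w)) = (if bideg w = c then derV d I A (mon w) else 0)"
  proof (cases "bideg w = c")
    case True
    have "bicomp c (derV d I A (mon w)) = derV d I A (mon w)"
      using derV_mon_bideg[of d I A w]
      by (rule lin_eq_on_span[OF lin_bicomp lin_id]) (auto simp: bicomp_mon True)
    then show ?thesis using True by simp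
  next
    case False
    have "bicomp c (derV d I A (mon w)) = 0"
      using derV_mon_bideg[of d I A w]
      by (rule lin_eq_on_span[OF lin_bicomp sder_lin[OF sder_0]]) (auto simp: bicomp_mon False)
    then show ?thesis using False by simp
  qed
  then show "derV d I A (bicomp c (mon w)) = bicomp c (derV d I A (mon w))"
    by (simp add: bicomp_mon lin_0[OF lin_hom_superder])
qed

section \<open>The identity matrix and the bidegree\<close>

definition delta :: "idx set \<Rightarrow> idx \<Rightarrow> idx \<Rightarrow> complex"
  where "delta I i j = (if i = j \<and> i \<in> I then 1 else 0)"

text \<open>The identity acts by 1 on each \<open>x\<close> and by -1 on each
  \<open>x\<^sup>*\<close>, so it is the difference of the two degree operators.\<close>

lemma derV_delta:
  assumes I: "finite I" and w: "set w \<subseteq> gset T S I"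
  shows "derV False I (delta I) (mon w)
    = scale (of_nat (fst (bideg w)) - of_nat (snd (bideg w))) (mon w)"
  using w
proof (induction w)
  case Nil
  then show ?case by (simp add: sder_1[OF sder_hom_superder] bideg_def)
next
  case (Cons g w)
  have IH: "derV False I (delta I) (mon w)
    = scale (of_nat (fst (bideg w)) - of_nat (snd (bideg w))) (mon w)"
    using Cons by simp
  show ?case
  proof (cases g)
    case (X t i)
    have "derV False I (delta I) (sgen g) = (\<Sum>j\<in>I. if j = i then sgen g else 0)"
      unfolding X derV_X by (intro sum.cong refl) (auto simp: delta_def koszul_def)
    also have "\<dots> = sgen g" using I Cons.prems X by simp
    finally show ?thesis
      by (simp add: sder_mult[OF sder_hom_superder] IH scale_mult_right)
        (simp add: X bideg_def algebra_simps scale_add_left sv.scale_left_diff_distrib)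
  next
    case (Xd i s)
    have "derV False I (delta I) (sgen g) = (\<Sum>j\<in>I. if j = i then - sgen g else 0)"
      unfolding Xd derV_Xd by (intro sum.cong refl) (auto simp: delta_def koszul_def)
    also have "\<dots> = - sgen g" using I Cons.prems Xd by simp
    finally show ?thesis
      by (simp add: sder_mult[OF sder_hom_superder] IH scale_mult_right)
        (simp add: Xd bideg_def algebra_simps scale_add_left sv.scale_left_diff_distrib)
  qed
qed

text \<open>Invariance freed from \<open>T\<close> and \<open>S\<close>, since the argument leaves
  the original algebra when the copy of the basis of \<open>V\<close> is adjoined to
  \<open>T\<close>.\<close>

definition annihilated :: "idx set \<Rightarrow> gen symalg \<Rightarrow> bool"
  where "annihilated I a \<longleftrightarrow> (\<forall>d. \<forall>A\<in>gl I. derV d I A a = 0)"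

lemma annihilated_diff: "annihilated I a \<Longrightarrow> annihilated I b \<Longrightarrow> annihilated I (a - b)"
  by (simp add: annihilated_def lin_diff[OF lin_hom_superder])

lemma annihilated_span: "(\<And>x. x \<in> B \<Longrightarrow> annihilated I x) \<Longrightarrow> a \<in> sv.span B \<Longrightarrow> annihilated I a"
  unfolding annihilated_def
  using lin_eq_on_span[OF lin_hom_superder sder_lin[OF sder_0], of a B _ "gl_V_gen I _"] by blast

lemma annihilated_derU: "annihilated I a \<Longrightarrow> annihilated I (derU d T A a)"
  by (simp add: annihilated_def derV_derU lin_0[OF lin_hom_superder])

text \<open>The identity matrix separates the bidegrees \<open>(r, s)\<close> with \<open>r \<noteq> s\<close>.\<close>

lemma invariants_bihomogeneous:
  assumes I: "finite I"
    and hom: "\<And>r b. b \<in> sv.span (mon ` {w. set w \<subseteq> gset T S I \<and> bideg w = (r, r)})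
      \<Longrightarrow> annihilated I b \<Longrightarrow> b \<in> sv.span Z"
    and a: "a \<in> invariants T S I (gl I)"
  shows "a \<in> sv.span Z"
proof -
  obtain K where K: "finite K" "a = (\<Sum>c\<in>K. bicomp c a)" using bicomp_decomposition by blast
  have "bicomp c a \<in> sv.span Z" for c
  proof (cases "fst c = snd c")
    case True
    then obtain r where c: "c = (r, r)" by (cases c) auto
    show ?thesis unfolding c
    proof (rule hom)
      show "bicomp (r, r) a \<in> sv.span (mon ` {w. set w \<subseteq> gset T S I \<and> bideg w = (r, r)})"
        using a by (intro bicomp_mixed) (simp add: invariants_iff)
      show "annihilated I (bicomp (r, r) a)"
        using a by (simp add: annihilated_def derV_bicomp invariants_iff lin_0[OF lin_bicomp])
    qed
  next
    case False
    let ?k = "of_nat (fst c) - of_nat (snd c) :: complex"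
    have "bicomp c a \<in> sv.span (mon ` {w. set w \<subseteq> gset T S I \<and> bideg w = c})"
      using a by (intro bicomp_mixed) (simp add: invariants_iff)
    then have "derV False I (delta I) (bicomp c a) = scale ?k (bicomp c a)"
      by (rule lin_eq_on_span[OF lin_hom_superder lin_scaled[OF lin_id]]) (auto simp: derV_delta[OF I])
    moreover have "delta I \<in> gl I" by (auto simp: gl_def delta_def)
    then have "derV False I (delta I) (bicomp c a) = 0"
      using a by (simp add: derV_bicomp invariants_iff lin_0[OF lin_bicomp])
    ultimately have "bicomp c a = 0" using False by simp
    then show ?thesis by (simp add: sv.span_zero)
  qed
  then show ?thesis by (subst K(2)) (intro sv.span_sum)
qed

section \<open>Iterated derivatives and Euler's identity\<close>

definition pds :: "gen list \<Rightarrow> gen symalg \<Rightarrow> gen symalg"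
  where "pds ws a = foldr pd ws a"

lemma pds_simps [simp]: "pds [] a = a" "pds (x # ws) a = pd x (pds ws a)"
  "pds (ws @ [x]) a = pds ws (pd x a)"
  by (simp_all add: pds_def)

lemma pd_mon: "pd x (mon w) \<in> sv.span {mon (u @ v) | u v. w = u @ x # v}"
proof (induction w)
  case Nil
  then show ?case by (simp add: sv.span_zero)
next
  case (Cons g w)
  have "sgen g * pd x (mon w) \<in> sv.span {mon (u @ v) | u v. g # w = u @ x # v}"
  proof (rule lin_span[OF lin_multL Cons.IH])
    fix z assume "z \<in> {mon (u @ v) | u v. w = u @ x # v}"
    then obtain u v where "z = mon (u @ v)" "w = u @ x # v" by blast
    then have "sgen g * z = mon ((g # u) @ v)" "g # w = (g # u) @ x # v" by simp_all
    then show "sgen g * z \<in> sv.span {mon (u @ v) | u v. g # w = u @ x # v}"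
      by (intro sv.span_base) blast
  qed
  moreover have "(if g = x then mon w else 0) \<in> sv.span {mon (u @ v) | u v. g # w = u @ x # v}"
  proof (cases "g = x")
    case True
    then have "mon w = mon ([] @ w)" "g # w = [] @ x # w" by simp_all
    then have "mon w \<in> {mon (u @ v) | u v. g # w = u @ x # v}" by blast
    then show ?thesis using True by (simp add: sv.span_base)
  qed (simp add: sv.span_zero)
  ultimately show ?case by (simp add: pd_sgen_mult sv.span_add sv.span_scale)
qed

text \<open>Euler's identity. Whatever the parity of \<open>g\<close>, the operator
  \<open>sgen g * pd g\<close> is even, so it passes the letter \<open>h\<close> without a sign and
  counts the occurrences of \<open>g\<close>.\<close>

lemma euler_mon:
  assumes "finite Q"
  shows "(\<Sum>g\<in>Q. sgen g * pd g (mon w)) = scale (of_nat (count_in Q w)) (mon w)"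
proof (induction w)
  case Nil
  then show ?case by simp
next
  case (Cons h w)
  have "(\<Sum>g\<in>Q. sgen g * pd g (mon (h # w)))
    = (\<Sum>g\<in>Q. (if h = g then sgen g * mon w else 0) + sgen h * (sgen g * pd g (mon w)))"
  proof (intro sum.cong refl)
    fix g
    have "scale (koszul (is_odd g) (is_odd h)) (sgen g * (sgen h * z)) = sgen h * (sgen g * z)" for z
      by (simp add: sgen_commute[of g h] scale_mult_left flip: mult.assoc)
    then show "sgen g * pd g (mon (h # w))
        = (if h = g then sgen g * mon w else 0) + sgen h * (sgen g * pd g (mon w))"
      by (simp add: pd_sgen_mult distrib_left scale_mult_right)
  qed
  also have "\<dots> = (if h \<in> Q then sgen h * mon w else 0)
      + sgen h * (\<Sum>g\<in>Q. sgen g * pd g (mon w))"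
    using assms by (simp add: sum.distrib sum_distrib_left)
  also have "\<dots> = scale (of_nat (count_in Q (h # w))) (mon (h # w))"
    by (simp add: Cons scale_mult_right scale_add_left)
  finally show ?case .
qed

lemma euler:
  assumes "finite Q" "a \<in> sv.span (mon ` {w. count_in Q w = r})"
  shows "(\<Sum>g\<in>Q. sgen g * pd g a) = scale (of_nat r) a"
proof (rule lin_eq_on_span[OF _ lin_scaled[OF lin_id] assms(2)])
  have "lin (\<lambda>a. sgen g * pd g a)" for g :: 'a by (rule lin_comp[OF lin_multL lin_pd])
  then show "lin (\<lambda>a. \<Sum>g\<in>Q. sgen g * pd g a)"
    by (simp add: lin_def sum.distrib sv.scale_sum_right)
qed (auto simp: euler_mon[OF assms(1)])

lemma pd_count_in:
  assumes "g \<in> Q" "a \<in> sv.span (mon ` {w. count_in Q w = Suc r})"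
  shows "pd g a \<in> sv.span (mon ` {w. count_in Q w = r})"
  using assms(2)
proof (rule lin_span[OF lin_pd])
  fix z assume "z \<in> mon ` {w. count_in Q w = Suc r}"
  then obtain w where w: "z = mon w" "count_in Q w = Suc r" by blast
  have "{mon (u @ v) | u v. w = u @ g # v} \<subseteq> mon ` {w. count_in Q w = r}"
    using w assms(1) by auto
  then show "pd g z \<in> sv.span (mon ` {w. count_in Q w = r})"
    unfolding w(1) by (rule set_mp[OF sv.span_mono pd_mon])
qed

text \<open>If all first derivatives along \<open>Q\<close> vanish, Euler's identity makes a nonzero
  integer multiple of \<open>a\<close> vanish; descending on the degree reduces this to derivatives
  of order \<open>r\<close>.\<close>

lemma pds_eq_0:
  assumes "finite Q" "a \<in> sv.span (mon ` {w. count_in Q w = r})"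
    and "\<And>ws. length ws = r \<Longrightarrow> set ws \<subseteq> Q \<Longrightarrow> pds ws a = 0"
  shows "a = 0"
  using assms(2,3)
proof (induction r arbitrary: a)
  case 0
  from "0.prems"(2)[of "[]"] show ?case by simp
next
  case (Suc r)
  have "pd g a = 0" if "g \<in> Q" for g
  proof (rule Suc.IH)
    show "pd g a \<in> sv.span (mon ` {w. count_in Q w = r})"
      using that Suc.prems(1) by (rule pd_count_in)
    show "pds ws (pd g a) = 0" if "length ws = r" "set ws \<subseteq> Q" for ws
      using Suc.prems(2)[of "ws @ [g]"] that \<open>g \<in> Q\<close> by simp
  qed
  then have "scale (of_nat (Suc r)) a = 0"
    using euler[OF assms(1) Suc.prems(1)] by simp
  then show ?case by (simp del: of_nat_Suc)
qed

lemma lin_zero: "lin (\<lambda>a. 0)"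
  by (simp add: lin_def)

lemma lin_vanish_span:
  assumes "lin D" "a \<in> sv.span A" "\<And>x. x \<in> A \<Longrightarrow> D x = 0"
  shows "D a = 0"
  using assms by (rule lin_eq_on_span[OF _ lin_zero])

lemma count_in_eq_0: "count_in Q w = 0 \<longleftrightarrow> set w \<inter> Q = {}"
  by (induction w) auto

lemma count_in_eq_length: "set w \<subseteq> Q \<Longrightarrow> count_in Q w = length w"
  by (induction w) auto

section \<open>Evaluation at the identity matrix\<close>

text \<open>The polarization given by the matrix unit from \<open>u\<^sub>t\<close> to
  \<open>u\<^sub>k\<close>. Taking \<open>{k}\<close> as the index set leaves only row
  \<open>k\<close> in the sum, so the matrix may ignore its row index.\<close>

definition pol :: "idx \<Rightarrow> idx \<Rightarrow> gen symalg \<Rightarrow> gen symalg"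
  where "pol k t = derU (is_odd k \<noteq> is_odd t) {k} (\<lambda>r t'. if t' = t then 1 else 0)"

lemma sder_pol: "sder (is_odd k \<noteq> is_odd t) (pol k t)"
  unfolding pol_def by (rule sder_hom_superder)

lemma lin_pol: "lin (pol k t)"
  using sder_pol by (rule sder_lin)

lemma pol_X: "pol k t (sgen (X t' i)) = (if t' = t then sgen (X k i) else 0)"
  by (auto simp: pol_def derU_X)

lemma pol_Xd: "pol k t (sgen (Xd i s)) = 0"
  by (simp add: pol_def derU_Xd)

lemma pol_scalar_product:
  "pol k t (scalar_product I t' s) = (if t' = t then scalar_product I k s else 0)"
  by (simp add: scalar_product_def lin_sum[OF lin_pol] sder_mult[OF sder_pol] pol_X pol_Xd)

lemma ptwist_scalar_product:
  "ptwist d (scalar_product I t s) = scale (koszul d (is_odd t \<noteq> is_odd s)) (scalar_product I t s)"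
  unfolding scalar_product_def lin_sum[OF lin_ptwist] sv.scale_sum_right ptwist_mult ptwist_sgen
    scale_mult_left scale_mult_right scale_scale
  by (intro sum.cong refl arg_cong2[of _ _ _ _ scale]) (auto simp: koszul_def)

section \<open>Products of scalar products and their polarizations\<close>

definition spl :: "idx set \<Rightarrow> (idx \<times> idx) list \<Rightarrow> gen symalg"
  where "spl I w = prod_list (map (case_prod (scalar_product I)) w)"

lemma spl_simps [simp]: "spl I [] = 1" "spl I (ts # w) = scalar_product I (fst ts) (snd ts) * spl I w"
  by (simp_all add: spl_def case_prod_beta)

lemma annihilated_spl: "annihilated I (spl I w)"
  by (induction w)
    (simp_all add: annihilated_def sder_1[OF sder_hom_superder] sder_mult[OF sder_hom_superder]
      derV_scalar_product)

lemma pol_spl: "pol k t (spl I w) \<in> sv.span {spl I (u @ (k, s) # v) | u v s. w = u @ (t, s) # v}"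
proof -
  let ?R = "\<lambda>(t', s). if t' = t then {(k, s)} else {}"
  have "pol k t (prod_list (map (case_prod (scalar_product I)) w))
    \<in> sv.span {prod_list (map (case_prod (scalar_product I)) (u @ y # v)) | u x y v.
        w = u @ x # v \<and> y \<in> ?R x}"
    by (rule der_prod[OF sder_pol])
      (auto simp: ptwist_scalar_product pol_scalar_product sv.span_zero intro: sv.span_base)
  also have "\<dots> \<subseteq> sv.span {spl I (u @ (k, s) # v) | u v s. w = u @ (t, s) # v}"
    by (rule sv.span_mono) (auto simp: spl_def split: if_splits)
  finally show ?thesis by (simp add: spl_def)
qed

lemma pol_mon: "pol k t (mon w) \<in> sv.span {mon (u @ X k i # v) | u v i. w = u @ X t i # v}"
proof -
  let ?R = "\<lambda>g. {X k i | i. g = X t i}"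
  have "pol k t (sgen g) \<in> sv.span (sgen ` ?R g)" for g
    by (cases g) (auto simp: pol_X pol_Xd sv.span_zero intro: sv.span_base)
  then have "pol k t (mon w) \<in> sv.span {mon (u @ y # v) | u x y v. w = u @ x # v \<and> y \<in> ?R x}"
    by (rule der_mon[OF sder_pol])
  also have "\<dots> \<subseteq> sv.span {mon (u @ X k i # v) | u v i. w = u @ X t i # v}"
    by (rule sv.span_mono) auto
  finally show ?thesis .
qed

text \<open>The matrix unit that sends \<open>e\<^sub>i\<close> to \<open>e\<^sub>j\<close>.\<close>

definition elem :: "idx \<Rightarrow> idx \<Rightarrow> idx \<Rightarrow> idx \<Rightarrow> complex"
  where "elem j i = (\<lambda>p q. if p = j \<and> q = i then 1 else 0)"

lemma derV_elem_X:
  assumes "finite I" "j \<in> I"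
  shows "derV (is_odd i \<noteq> is_odd j) I (elem j i) (sgen (X t i'))
    = (if i' = i then scale (koszul (is_odd i \<noteq> is_odd j) (is_odd t)) (sgen (X t j)) else 0)"
proof -
  have "derV (is_odd i \<noteq> is_odd j) I (elem j i) (sgen (X t i')) = (\<Sum>q\<in>I. if q = j then
    (if i' = i then scale (koszul (is_odd i \<noteq> is_odd j) (is_odd t)) (sgen (X t j)) else 0) else 0)"
    unfolding derV_X by (intro sum.cong refl) (auto simp: elem_def)
  then show ?thesis using assms by simp
qed

text \<open>The supercommutator of a matrix unit with a partial derivative is a multiple of a
  partial derivative in the same row \<open>t\<close>. In \<open>ev_inj\<close> this shows that the
  derivatives of a fixed order span a space stable under matrix units.\<close>

lemma derV_pd:
  fixes i j
  defines "d \<equiv> is_odd i \<noteq> is_odd j"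
  assumes I: "finite I" "j \<in> I"
  shows "\<exists>c c'. derV d I (elem j i) (pd (X t i') b)
    = scale c (pd (X t i') (derV d I (elem j i) b)) + scale c' (pd (X t i) b)"
proof -
  let ?D = "derV d I (elem j i)" and ?x = "X t i'"
  \<comment> \<open>Only the generator \<open>X t i\<close> contributes: the matrix unit turns it
    into a multiple of \<open>X t j\<close>, which the derivative along \<open>X t i'\<close>
    detects exactly when \<open>i' = j\<close>.\<close>
  let ?c' = "if i' = j then - koszul d (is_odd ?x) * koszul d (is_odd t) else 0"
  have gen: "?D (pd ?x (sgen g)) - scale (koszul d (is_odd ?x)) (pd ?x (?D (sgen g)))
    = scale ?c' (pd (X t i) (sgen g))" for g
  proof (cases g)
    case (X t' i'')
    have D: "?D (sgen g) = (if i'' = i then scale (koszul d (is_odd t')) (sgen (X t' j)) else 0)"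
      using derV_elem_X[OF I] by (simp add: X d_def)
    have "?D (pd ?x (sgen g)) = 0"
      by (simp add: pd_sgen sder_1[OF sder_hom_superder] lin_0[OF lin_hom_superder])
    then show ?thesis
      unfolding D by (auto simp: X pd_sgen lin_scale[OF lin_pd] lin_0[OF lin_pd] simp del: is_odd_gen.simps)
  next
    case (Xd i'' s)
    then show ?thesis
      by (simp add: pd_sgen lin_0[OF lin_hom_superder] derV_Xd lin_sum[OF lin_pd] lin_scale[OF lin_pd])
  qed
  have "?D (pd ?x b) - scale (koszul d (is_odd ?x)) (pd ?x (?D b)) = scale ?c' (pd (X t i) b)"
  \<comment> \<open>For \<open>i' = j\<close> the parities add up to that of \<open>X t i\<close>,
    so both sides are superderivations of the same parity; otherwise the comparison is with the zero
    derivation.\<close>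
  proof (cases "i' = j")
    case True
    then have p: "(d \<noteq> is_odd ?x) = is_odd (X t i)" by (auto simp: d_def)
    have "sder (d \<noteq> is_odd ?x) (\<lambda>b. scale ?c' (pd (X t i) b))"
      unfolding p using sder_pd[of "X t i"]
      by (simp add: sder_def lin_scaled scale_add_right scale_mult_left scale_mult_right
          lin_scale[OF lin_ptwist] mult.commute mult.left_commute del: is_odd_gen.simps)
    then show ?thesis
      by (rule sder_eqI[OF sder_supercommutator[OF sder_hom_superder sder_pd]]) (rule gen)
  next
    case False
    have "?D (pd ?x b) - scale (koszul d (is_odd ?x)) (pd ?x (?D b)) = 0"
      by (rule sder_eqI[OF sder_supercommutator[OF sder_hom_superder sder_pd] sder_0])
        (use gen False in simp)
    with False show ?thesis by simp
  qed
  then show ?thesis by (metis diff_add_cancel add.commute)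
qed

text \<open>The copy \<open>\<iota> ` I\<close> of the basis of \<open>V\<close>, placed among the indices of \<open>U\<close>, makes
  \<open>(x\<^sub>t\<^sub>i)\<close> with \<open>t \<in> \<iota> ` I\<close> a generic square supermatrix.\<close>

locale doubled_index =
  fixes T S I :: "idx set" and \<iota> :: "idx \<Rightarrow> idx"
  assumes fin: "finite T" "finite S" "finite I"
    and inj: "inj \<iota>" and par [simp]: "is_odd (\<iota> i) = is_odd i" and disj [simp]: "\<iota> i \<notin> T"
begin

text \<open>The numbers \<open>a\<close>, \<open>b\<close>, \<open>c\<close> are the degrees in the
  original \<open>x\<close>, in the copied \<open>x\<close> and in the
  \<open>x\<^sup>*\<close>.\<close>

definition W :: "nat \<Rightarrow> nat \<Rightarrow> nat \<Rightarrow> gen list set"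
  where "W a b c = {w. set w \<subseteq> gset (T \<union> \<iota> ` I) S I \<and> count_in (gset T {} I) w = a
    \<and> count_in (gset (\<iota> ` I) {} I) w = b \<and> count_in (gset {} S I) w = c}"

definition mspan :: "nat \<Rightarrow> nat \<Rightarrow> nat \<Rightarrow> gen symalg set"
  where "mspan a b c = sv.span (mon ` W a b c)"

definition PW :: "nat \<Rightarrow> nat \<Rightarrow> (idx \<times> idx) list set"
  where "PW a b = {w. set w \<subseteq> (T \<union> \<iota> ` I) \<times> S \<and> count_in (T \<times> S) w = a \<and> count_in (\<iota> ` I \<times> S) w = b}"

definition pspan :: "nat \<Rightarrow> nat \<Rightarrow> gen symalg set"
  where "pspan a b = sv.span (spl I ` PW a b)"

lemma not_copy: "t \<in> T \<Longrightarrow> t \<notin> \<iota> ` I"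
  using disj by blast

lemma pol_mspan_to_copy:
  assumes "t \<in> T" "k \<in> \<iota> ` I" "x \<in> mspan (Suc a) b c"
  shows "pol k t x \<in> mspan a (Suc b) c"
  using assms(3) unfolding mspan_def
proof (rule lin_span[OF lin_pol])
  fix z assume "z \<in> mon ` W (Suc a) b c"
  then obtain w where w: "z = mon w" "w \<in> W (Suc a) b c" by blast
  have "{mon (u @ X k i # v) | u v i. w = u @ X t i # v} \<subseteq> mon ` W a (Suc b) c"
    using w(2) assms(1,2) not_copy by (auto simp: W_def)
  then show "pol k t z \<in> sv.span (mon ` W a (Suc b) c)"
    unfolding w(1) by (rule set_mp[OF sv.span_mono pol_mon])
qed

lemma pol_pspan_from_copy:
  assumes "t \<in> \<iota> ` I" "k \<in> T" "x \<in> pspan a (Suc b)"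
  shows "pol k t x \<in> pspan (Suc a) b"
  using assms(3) unfolding pspan_def
proof (rule lin_span[OF lin_pol])
  fix z assume "z \<in> spl I ` PW a (Suc b)"
  then obtain w where w: "z = spl I w" "w \<in> PW a (Suc b)" by blast
  have "{spl I (u @ (k, s) # v) | u v s. w = u @ (t, s) # v} \<subseteq> spl I ` PW (Suc a) b"
    using w(2) assms(1,2) not_copy by (auto simp: PW_def)
  then show "pol k t z \<in> sv.span (spl I ` PW (Suc a) b)"
    unfolding w(1) by (rule set_mp[OF sv.span_mono pol_spl])
qed

lemma spl_mspan:
  "set w \<subseteq> (T \<union> \<iota> ` I) \<times> S
    \<Longrightarrow> spl I w \<in> mspan (count_in (T \<times> S) w) (count_in (\<iota> ` I \<times> S) w) (length w)"
proof (induction w)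
  case Nil
  have "mon [] \<in> mon ` W 0 0 0" by (rule imageI) (simp add: W_def)
  then show ?case by (simp add: mspan_def sv.span_base)
next
  case (Cons p w)
  obtain t s where p: "p = (t, s)" by fastforce
  let ?C = "mspan (count_in (T \<times> S) (p # w)) (count_in (\<iota> ` I \<times> S) (p # w)) (length (p # w))"
  have "sgen (X t i) * (sgen (Xd i s) * spl I w) \<in> ?C" if "i \<in> I" for i
    unfolding mspan_def
  proof (rule lin_span[OF lin_comp[OF lin_multL lin_multL]])
    show "spl I w \<in> sv.span (mon ` W (count_in (T \<times> S) w) (count_in (\<iota> ` I \<times> S) w) (length w))"
      using Cons by (simp add: mspan_def)
    fix z assume "z \<in> mon ` W (count_in (T \<times> S) w) (count_in (\<iota> ` I \<times> S) w) (length w)"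
    then obtain v where v: "z = mon v" "v \<in> W (count_in (T \<times> S) w) (count_in (\<iota> ` I \<times> S) w) (length w)"
      by blast
    have "X t i # Xd i s # v \<in> W (count_in (T \<times> S) (p # w)) (count_in (\<iota> ` I \<times> S) (p # w)) (length (p # w))"
      using v(2) Cons.prems that by (auto simp: W_def p)
    then have "mon (X t i # Xd i s # v)
      \<in> mon ` W (count_in (T \<times> S) (p # w)) (count_in (\<iota> ` I \<times> S) (p # w)) (length (p # w))"
      by (rule imageI)
    then show "sgen (X t i) * (sgen (Xd i s) * z)
      \<in> sv.span (mon ` W (count_in (T \<times> S) (p # w)) (count_in (\<iota> ` I \<times> S) (p # w)) (length (p # w)))"
      using v(1) by (simp add: sv.span_base)
  qed
  moreover have "spl I (p # w) = (\<Sum>i\<in>I. sgen (X t i) * (sgen (Xd i s) * spl I w))"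
    by (simp add: p scalar_product_def sum_distrib_right mult.assoc)
  ultimately show ?case unfolding mspan_def by (metis (no_types, lifting) sv.span_sum)
qed

lemma count_in_pairs: "set w \<subseteq> (T \<union> \<iota> ` I) \<times> S \<Longrightarrow> count_in (T \<times> S) w + count_in (\<iota> ` I \<times> S) w = length w"
  using not_copy by (induction w) auto

lemma pspan_mspan: "pspan a b \<subseteq> mspan a b (a + b)"
proof -
  have "spl I ` PW a b \<subseteq> mspan a b (a + b)"
  proof (rule image_subsetI)
    fix w assume "w \<in> PW a b"
    then show "spl I w \<in> mspan a b (a + b)"
      using spl_mspan[of w] count_in_pairs[of w] by (auto simp: PW_def)
  qed
  then show ?thesis unfolding pspan_def mspan_def by (rule sv.span_minimal) (rule sv.subspace_span)
qed

lemma annihilated_pspan: "x \<in> pspan a b \<Longrightarrow> annihilated I x"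
  unfolding pspan_def by (rule annihilated_span[rotated]) (auto intro: annihilated_spl)

section \<open>The evaluation homomorphism\<close>

fun ev_gen :: "gen \<Rightarrow> gen symalg" where
  "ev_gen (X t i) = (if t \<in> \<iota> ` I then (if t = \<iota> i then 1 else 0) else sgen (X t i))"
| "ev_gen (Xd i s) = sgen (Xd i s)"

definition ev :: "gen symalg \<Rightarrow> gen symalg"
  where "ev = shom ev_gen"

text \<open>Only diagonal entries of the square supermatrix become 1, and these are even; hence the
  specialization is compatible with the supercommutation relations.\<close>

lemma ev_gen_cases:
  obtains "ev_gen g = 1" "\<not> is_odd g" | "ev_gen g = 0" | "ev_gen g = sgen g"
proof (cases g)
  case (X t i)
  then show thesis using that by (cases "t \<in> \<iota> ` I"; cases "t = \<iota> i") auto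
qed (use that in auto)

lemma ev_gen_commute:
  "ev_gen g * ev_gen h = scale (koszul (is_odd g) (is_odd h)) (ev_gen h * ev_gen g)"
proof (cases g rule: ev_gen_cases)
  case 1
  then show ?thesis by (simp add: koszul_def)
next
  case 3
  then show ?thesis
  proof (cases h rule: ev_gen_cases)
    case 3
    then show ?thesis using \<open>ev_gen g = sgen g\<close> by (simp flip: sgen_commute)
  qed (simp_all add: koszul_def)
qed simp

lemma multiplicative_ev: "multiplicative ev" and ev_sgen: "ev (sgen g) = ev_gen g"
  unfolding ev_def by (rule shom[OF ev_gen_commute])+

lemma lin_ev: "lin ev" and ev_1 [simp]: "ev 1 = 1" and ev_mult: "ev (a * b) = ev a * ev b"
  using multiplicative_ev by (simp_all add: multiplicative_def)

lemma ev_ptwist: "ev (ptwist e a) = ptwist e (ev a)"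
proof (rule mult_lin_eqI[OF lin_comp[OF lin_ev lin_ptwist] lin_comp[OF lin_ptwist lin_ev]])
  show "ev (ptwist e (sgen g)) = ptwist e (ev (sgen g))" for g
    by (cases g rule: ev_gen_cases)
      (simp_all add: ptwist_sgen lin_scale[OF lin_ev] ev_sgen koszul_def lin_0[OF lin_ptwist])
qed (simp_all add: ev_mult ptwist_mult)

lemma ev_mspan_id: "x \<in> mspan a 0 c \<Longrightarrow> ev x = x"
  unfolding mspan_def
proof (rule lin_eq_on_span[OF lin_ev lin_id], assumption)
  fix z assume "z \<in> mon ` W a 0 c"
  then obtain w where w: "z = mon w" "set w \<subseteq> gset (T \<union> \<iota> ` I) S I"
      "set w \<inter> gset (\<iota> ` I) {} I = {}"
    by (auto simp: W_def count_in_eq_0)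
  have "ev (mon w) = mon w" using w(2,3)
  proof (induction w)
    case (Cons g w)
    then have "ev_gen g = sgen g" by (cases g) auto
    with Cons show ?case by (simp add: ev_mult ev_sgen)
  qed simp
  then show "ev z = z" by (simp add: w)
qed

lemma ev_mspan:
  assumes "x \<in> mspan 0 b c"
  shows "ev x \<in> mspan 0 0 c"
  using assms unfolding mspan_def
proof (rule lin_span[OF lin_ev])
  fix z assume "z \<in> mon ` W 0 b c"
  then obtain w where w: "z = mon w" "set w \<subseteq> gset (T \<union> \<iota> ` I) S I"
      "set w \<inter> gset T {} I = {}" "count_in (gset {} S I) w = c"
    by (auto simp: W_def count_in_eq_0)
  have "ev (mon w) \<in> mspan 0 0 (count_in (gset {} S I) w)" using w(2,3)
  proof (induction w)
    case Nil
    have "mon [] \<in> mon ` W 0 0 0" by (rule imageI) (simp add: W_def)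
    then show ?case by (simp add: mspan_def sv.span_base)
  next
    case (Cons g w)
    show ?case
    proof (cases g)
      case (X t i)
      with Cons show ?thesis
        by (auto simp: ev_mult ev_sgen mspan_def sv.span_zero)
    next
      case (Xd i s)
      have "sgen g * ev (mon w) \<in> mspan 0 0 (Suc (count_in (gset {} S I) w))"
        unfolding mspan_def
      proof (rule lin_span[OF lin_multL])
        show "ev (mon w) \<in> sv.span (mon ` W 0 0 (count_in (gset {} S I) w))"
          using Cons by (simp add: mspan_def)
        fix z assume "z \<in> mon ` W 0 0 (count_in (gset {} S I) w)"
        then obtain v where v: "z = mon v" "v \<in> W 0 0 (count_in (gset {} S I) w)" by blast
        have "mon (g # v) \<in> mon ` W 0 0 (Suc (count_in (gset {} S I) w))"
          using v(2) Cons.prems Xd by (intro imageI) (auto simp: W_def)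
        then show "sgen g * z \<in> sv.span (mon ` W 0 0 (Suc (count_in (gset {} S I) w)))"
          by (simp add: v(1) sv.span_base)
      qed
      then show ?thesis using Cons.prems Xd by (simp add: ev_mult ev_sgen)
    qed
  qed
  then show "ev z \<in> sv.span (mon ` W 0 0 c)" by (simp add: w mspan_def)
qed

lemma ev_scalar_product:
  assumes "i \<in> I"
  shows "ev (scalar_product I (\<iota> i) s) = sgen (Xd i s)"
proof -
  have "ev (scalar_product I (\<iota> i) s) = (\<Sum>j\<in>I. if j = i then sgen (Xd i s) else 0)"
    unfolding scalar_product_def lin_sum[OF lin_ev]
    using assms inj by (intro sum.cong refl) (auto simp: ev_mult ev_sgen inj_eq)
  then show ?thesis using assms fin by simp
qed

text \<open>A word in the \<open>x\<^sup>*\<close> is lifted letter by letter: \<open>Xd i s\<close>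
  is the value of the scalar product of row \<open>\<iota> i\<close> with \<open>s\<close>.\<close>

lemma ev_pspan_surj:
  assumes "y \<in> mspan 0 0 r"
  obtains p where "p \<in> pspan 0 r" "ev p = y"
proof -
  have mon: "\<exists>v\<in>PW 0 (length w). ev (spl I v) = mon w" if "set w \<subseteq> gset {} S I" for w
    using that
  proof (induction w)
    case Nil
    have "[] \<in> PW 0 0" by (simp add: PW_def)
    then show ?case by (auto intro: bexI[of _ "[]"])
  next
    case (Cons g w)
    then obtain v where v: "v \<in> PW 0 (length w)" "ev (spl I v) = mon w" by auto
    from Cons.prems obtain i s where g: "g = Xd i s" "i \<in> I" "s \<in> S" by (cases g) auto
    have "(\<iota> i, s) # v \<in> PW 0 (length (g # w))" using v(1) g by (auto simp: PW_def)
    moreover have "ev (spl I ((\<iota> i, s) # v)) = mon (g # w)"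
      using v(2) g by (simp add: ev_mult ev_scalar_product)
    ultimately show ?case by blast
  qed
  have "\<exists>p\<in>pspan 0 r. ev p = y"
    using assms unfolding mspan_def
  proof (induction rule: sv.span_induct_alt)
    case base
    then show ?case by (auto simp: pspan_def sv.span_zero lin_0[OF lin_ev] intro!: bexI[of _ 0])
  next
    case (step c x y)
    from step(1) obtain w where w: "x = mon w" "w \<in> W 0 0 r" by blast
    have sub: "set w \<subseteq> gset {} S I"
    proof
      fix g assume "g \<in> set w"
      moreover have "set w \<subseteq> gset (T \<union> \<iota> ` I) S I" "set w \<inter> gset T {} I = {}"
        "set w \<inter> gset (\<iota> ` I) {} I = {}"
        using w(2) by (simp_all add: W_def count_in_eq_0)
      ultimately have "g \<in> gset (T \<union> \<iota> ` I) S I" "g \<notin> gset T {} I" "g \<notin> gset (\<iota> ` I) {} I"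
        by blast+
      then show "g \<in> gset {} S I" by (cases g) auto
    qed
    then have "length w = r" using w(2) count_in_eq_length[OF sub] by (simp add: W_def)
    then obtain v where v: "v \<in> PW 0 r" "ev (spl I v) = x" using mon[OF sub] w(1) by auto
    obtain p where p: "p \<in> pspan 0 r" "ev p = y" using step by blast
    have "scale c (spl I v) + p \<in> pspan 0 r"
      using v(1) p(1) unfolding pspan_def
      by (intro sv.span_add sv.span_scale) (auto intro: sv.span_base)
    then show ?case
      using v(2) p(2) by (auto simp: lin_add[OF lin_ev] lin_scale[OF lin_ev] intro!: bexI)
  qed
  then show thesis using that by blast
qed

text \<open>The polarization replaces \<open>X t i\<close> by \<open>X (\<iota> j) i\<close>, whose
  value at the identity is 1 for \<open>i = j\<close> and 0 otherwise. Thus polarizing into the copy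
  and evaluating amounts to differentiating along \<open>X t j\<close>.\<close>

lemma ev_pol:
  assumes "j \<in> I" "t \<in> T"
  shows "ev (pol (\<iota> j) t b) = pd (X t j) (ev b)"
proof (rule der_over_eqI[OF lin_comp[OF lin_ev lin_pol] lin_comp[OF lin_pd lin_ev] multiplicative_ev,
      where d = "is_odd j \<noteq> is_odd t"])
  fix a b
  show "ev (pol (\<iota> j) t (a * b)) = ev (pol (\<iota> j) t a) * ev b
      + ptwist (is_odd j \<noteq> is_odd t) (ev a) * ev (pol (\<iota> j) t b)"
    by (simp add: sder_mult[OF sder_pol] lin_add[OF lin_ev] ev_mult ev_ptwist)
  have "is_odd (X t j) = (is_odd j \<noteq> is_odd t)" by auto
  then show "pd (X t j) (ev (a * b)) = pd (X t j) (ev a) * ev b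
      + ptwist (is_odd j \<noteq> is_odd t) (ev a) * pd (X t j) (ev b)"
    by (simp only: ev_mult sder_mult[OF sder_pd])
next
  fix g
  show "ev (pol (\<iota> j) t (sgen g)) = pd (X t j) (ev (sgen g))"
    using assms inj not_copy
    by (cases g) (auto simp: pol_X pol_Xd ev_sgen lin_0[OF lin_ev] lin_0[OF lin_pd] pd_sgen inj_eq)
qed

text \<open>Along the orbit of the identity matrix, differentiating the generic matrix in the
  direction \<open>E\<^sub>j\<^sub>i\<close> amounts to acting by \<open>E\<^sub>j\<^sub>i \<in> gl(V)\<close>.\<close>

lemma ev_derV:
  fixes i j
  defines "d \<equiv> is_odd i \<noteq> is_odd j"
  assumes "i \<in> I" "j \<in> I"
  shows "ev (derV d I (elem j i) b)
    = scale (koszul d (is_odd j)) (ev (pd (X (\<iota> j) i) b)) + derV d I (elem j i) (ev b)"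
proof (rule der_over_eqI[OF lin_comp[OF lin_ev lin_hom_superder]
      lin_plus[OF lin_scaled[OF lin_comp[OF lin_ev lin_pd]] lin_comp[OF lin_hom_superder lin_ev]]
      multiplicative_ev, where d = d])
  let ?D = "derV d I (elem j i)" and ?x = "X (\<iota> j) i"
  fix a b
  show "ev (?D (a * b)) = ev (?D a) * ev b + ptwist d (ev a) * ev (?D b)"
    by (simp add: sder_mult[OF sder_hom_superder] lin_add[OF lin_ev] ev_mult ev_ptwist)
  have "is_odd ?x = d" by (auto simp: d_def)
  then have "pd ?x (a * b) = pd ?x a * b + ptwist d a * pd ?x b"
    using sder_mult[OF sder_pd, of ?x a b] by simp
  then show "scale (koszul d (is_odd j)) (ev (pd ?x (a * b))) + ?D (ev (a * b))
    = (scale (koszul d (is_odd j)) (ev (pd ?x a)) + ?D (ev a)) * ev b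
      + ptwist d (ev a) * (scale (koszul d (is_odd j)) (ev (pd ?x b)) + ?D (ev b))"
    by (simp add: sder_mult[OF sder_hom_superder] lin_add[OF lin_ev] ev_mult ev_ptwist
        scale_add_right scale_mult_left scale_mult_right distrib_left distrib_right)
next
  let ?D = "derV d I (elem j i)"
  fix g
  show "ev (?D (sgen g)) = scale (koszul d (is_odd j)) (ev (pd (X (\<iota> j) i) (sgen g))) + ?D (ev (sgen g))"
  proof (cases g)
    case (X t i')
    have D: "?D (sgen (X t i')) = (if i' = i then scale (koszul d (is_odd t)) (sgen (X t j)) else 0)"
      using derV_elem_X[OF fin(3) \<open>j \<in> I\<close>] by (simp add: d_def)
    show ?thesis
    proof (cases "t \<in> \<iota> ` I")
      case True
      then have "?D (ev (sgen g)) = 0"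
        by (simp add: X ev_sgen sder_1[OF sder_hom_superder] lin_0[OF lin_hom_superder])
      then show ?thesis
        using True \<open>j \<in> I\<close> unfolding X D
        by (auto simp: pd_sgen lin_scale[OF lin_ev] lin_0[OF lin_ev] ev_sgen)
    next
      case False
      then have "t \<noteq> \<iota> j" using \<open>j \<in> I\<close> by blast
      then have "pd (X (\<iota> j) i) (sgen g) = 0" by (simp add: X pd_sgen)
      then show ?thesis
        using False by (simp add: X D ev_sgen lin_scale[OF lin_ev] lin_0[OF lin_ev])
    qed
  next
    case (Xd i' s)
    then show ?thesis
      by (simp add: derV_Xd ev_sgen pd_sgen lin_sum[OF lin_ev] lin_scale[OF lin_ev] lin_0[OF lin_ev])
  qed
qed

text \<open>By induction on the order, all derivatives of \<open>x\<close> along the copied entries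
  vanish at the identity matrix. Those of order \<open>b\<close> contain no copied entry any more,
  so they are 0 themselves, and \<open>pds_eq_0\<close> applies.\<close>

lemma ev_inj:
  assumes x: "x \<in> mspan 0 b c" and inv: "annihilated I x" and ev: "ev x = 0"
  shows "x = 0"
proof -
  let ?Q = "gset (\<iota> ` I) {} I"
  define Z where "Z = (\<lambda>n. sv.span {pds ws x | ws. length ws = n \<and> set ws \<subseteq> ?Q})"
  have pd_Z: "pd g z \<in> Z (Suc n)" if "z \<in> Z n" "g \<in> ?Q" for g z n
    using that(1) unfolding Z_def
  proof (rule lin_span[OF lin_pd])
    fix z assume "z \<in> {pds ws x | ws. length ws = n \<and> set ws \<subseteq> ?Q}"
    then obtain ws where "z = pds ws x" "length ws = n" "set ws \<subseteq> ?Q" by blast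
    then have "pd g z = pds (g # ws) x" "length (g # ws) = Suc n" "set (g # ws) \<subseteq> ?Q"
      using that(2) by simp_all
    then show "pd g z \<in> sv.span {pds ws x | ws. length ws = Suc n \<and> set ws \<subseteq> ?Q}"
      by (intro sv.span_base) blast
  qed
  have elem: "elem j i \<in> gl I" if "i \<in> I" "j \<in> I" for i j
    using that by (auto simp: gl_def elem_def)
  have step: "z \<in> {pds ws x | ws. length ws = Suc n \<and> set ws \<subseteq> ?Q} \<Longrightarrow>
      \<exists>t i z'. z = pd (X t i) z' \<and> X t i \<in> ?Q \<and> z' \<in> Z n" for n z
  proof -
    assume "z \<in> {pds ws x | ws. length ws = Suc n \<and> set ws \<subseteq> ?Q}"
    then obtain g ws where z: "z = pd g (pds ws x)" "length ws = n" "g \<in> ?Q" "set ws \<subseteq> ?Q"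
      by (auto simp: length_Suc_conv)
    then have "pds ws x \<in> Z n" unfolding Z_def by (intro sv.span_base) blast
    then show "\<exists>t i z'. z = pd (X t i) z' \<and> X t i \<in> ?Q \<and> z' \<in> Z n"
      using z(1,3) by (cases g) auto
  qed
  \<comment> \<open>By \<open>derV_pd\<close> a matrix unit can be moved inside past each derivative
    until it reaches \<open>x\<close>, which it kills; the correction terms are derivatives of the
    same order.\<close>
  have D_Z: "derV (is_odd i \<noteq> is_odd j) I (elem j i) z \<in> Z n" if ij: "i \<in> I" "j \<in> I" and "z \<in> Z n"
    for i j z n
    using that(3)
  proof (induction n arbitrary: z)
    case 0
    then have "z \<in> sv.span {x}" by (simp add: Z_def)
    then have "derV (is_odd i \<noteq> is_odd j) I (elem j i) z = 0"
      by (rule lin_vanish_span[OF lin_hom_superder])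
        (use inv elem[OF ij] in \<open>simp add: annihilated_def\<close>)
    then show ?case by (simp add: Z_def sv.span_zero)
  next
    case (Suc n)
    have "z \<in> sv.span {pds ws x | ws. length ws = Suc n \<and> set ws \<subseteq> ?Q}"
      using Suc.prems unfolding Z_def .
    then have "derV (is_odd i \<noteq> is_odd j) I (elem j i) z \<in> sv.span (Z (Suc n))"
    proof (rule lin_span[OF lin_hom_superder])
      fix z assume "z \<in> {pds ws x | ws. length ws = Suc n \<and> set ws \<subseteq> ?Q}"
      then obtain t i' z' where z: "z = pd (X t i') z'" "X t i' \<in> ?Q" "z' \<in> Z n" using step by blast
      obtain k k' where "derV (is_odd i \<noteq> is_odd j) I (elem j i) z
        = scale k (pd (X t i') (derV (is_odd i \<noteq> is_odd j) I (elem j i) z')) + scale k' (pd (X t i) z')"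
        using derV_pd[OF fin(3) ij(2), of i t i' z'] z(1) by blast
      moreover have "pd (X t i') (derV (is_odd i \<noteq> is_odd j) I (elem j i) z') \<in> Z (Suc n)"
        using z by (intro pd_Z Suc.IH)
      moreover have "pd (X t i) z' \<in> Z (Suc n)"
        using z ij by (intro pd_Z) auto
      ultimately show "derV (is_odd i \<noteq> is_odd j) I (elem j i) z \<in> sv.span (Z (Suc n))"
        by (simp add: sv.span_add sv.span_scale sv.span_base)
    qed
    then show ?case unfolding Z_def by (simp add: sv.span_span)
  qed
  have ev_Z: "ev z = 0" if "z \<in> Z n" for z n
    using that
  proof (induction n arbitrary: z)
    case 0
    then have "z \<in> sv.span {x}" by (simp add: Z_def)
    then show ?case by (rule lin_vanish_span[OF lin_ev]) (simp add: ev)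
  next
    case (Suc n)
    show ?case
      using Suc.prems unfolding Z_def
    proof (rule lin_vanish_span[OF lin_ev])
      fix z assume "z \<in> {pds ws x | ws. length ws = Suc n \<and> set ws \<subseteq> ?Q}"
      then obtain t i z' where z: "z = pd (X t i) z'" "X t i \<in> ?Q" "z' \<in> Z n" using step by blast
      then obtain j where j: "t = \<iota> j" "j \<in> I" "i \<in> I" by auto
      let ?d = "is_odd i \<noteq> is_odd j"
      have "ev z' = 0" "ev (derV ?d I (elem j i) z') = 0"
        using Suc.IH D_Z[OF j(3,2)] z(3) by blast+
      \<comment> \<open>In \<open>ev_derV\<close> for \<open>z'\<close> the left side and the last
        term are 0, which leaves the new derivative up to sign.\<close>
      then have "scale (koszul ?d (is_odd j)) (ev z) = 0"
        using ev_derV[OF j(3,2), of z'] by (simp add: z(1) j(1) lin_0[OF lin_hom_superder])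
      then show "ev z = 0" by (auto simp: koszul_def split: if_splits)
    qed
  qed
  have Q: "finite ?Q" using fin by (simp add: finite_gset)
  have xQ: "x \<in> sv.span (mon ` {w. count_in ?Q w = b})"
    using x unfolding mspan_def by (rule set_mp[OF sv.span_mono, rotated]) (auto simp: W_def)
  have pds_mspan: "pds ws y \<in> mspan 0 b' c"
    if "length ws + b' = b''" "set ws \<subseteq> ?Q" "y \<in> mspan 0 b'' c" for ws b' b'' y
    using that
  proof (induction ws arbitrary: b')
    case (Cons g ws)
    have "pds ws y \<in> mspan 0 (Suc b') c" using Cons.prems by (intro Cons.IH) auto
    then have "pd g (pds ws y) \<in> mspan 0 b' c" unfolding mspan_def
    proof (rule lin_span[OF lin_pd])
      fix z assume "z \<in> mon ` W 0 (Suc b') c"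
      then obtain w where w: "z = mon w" "w \<in> W 0 (Suc b') c" by blast
      have g: "g \<notin> gset T {} I" "g \<notin> gset {} S I" "g \<in> ?Q"
        using Cons.prems(2) by (cases g; auto)+
      have "{mon (u @ v) | u v. w = u @ g # v} \<subseteq> mon ` W 0 b' c"
        using w(2) g by (auto simp: W_def)
      then show "pd g z \<in> sv.span (mon ` W 0 b' c)"
        unfolding w(1) by (rule set_mp[OF sv.span_mono pd_mon])
    qed
    then show ?case by simp
  qed simp
  show ?thesis
  proof (rule pds_eq_0[OF Q xQ])
    fix ws assume ws: "length ws = b" "set ws \<subseteq> ?Q"
    then have "ev (pds ws x) = pds ws x"
      using x by (intro ev_mspan_id) (rule pds_mspan[of _ _ b], simp_all)
    moreover have "pds ws x \<in> Z b" unfolding Z_def using ws by (intro sv.span_base) blast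
    ultimately show "pds ws x = 0" using ev_Z by metis
  qed
qed

text \<open>Some combination \<open>p\<close> of products of scalar products agrees with
  \<open>x\<close> at the identity; the difference is annihilated and has value 0 there, so
  \<open>ev_inj\<close> makes it vanish.\<close>

lemma annihilated_copy_imp_pspan:
  assumes "x \<in> mspan 0 r r" "annihilated I x"
  shows "x \<in> pspan 0 r"
proof -
  obtain p where p: "p \<in> pspan 0 r" "ev p = ev x"
    using ev_pspan_surj[OF ev_mspan[OF assms(1)]] .
  have "p \<in> mspan 0 r r" using p(1) pspan_mspan[of 0 r] by auto
  then have "x - p \<in> mspan 0 r r" using assms(1) unfolding mspan_def by (rule sv.span_diff[rotated])
  moreover have "annihilated I (x - p)"
    using assms(2) annihilated_pspan[OF p(1)] by (rule annihilated_diff)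
  moreover have "ev (x - p) = 0" by (simp add: lin_diff[OF lin_ev] p(2))
  ultimately have "x - p = 0" by (rule ev_inj)
  then show ?thesis using p by simp
qed

end

section \<open>The Fischer form\<close>

text \<open>The Fischer form in degree \<open>n\<close>, for which multiplication by a generator is up to a
  factor adjoint to the derivative along it.\<close>

fun form :: "'g::superindex set \<Rightarrow> nat \<Rightarrow> 'g symalg \<Rightarrow> 'g symalg \<Rightarrow> complex" where
  "form G 0 a b = cnj (counit a) * counit b"
| "form G (Suc n) a b = (\<Sum>g\<in>G. form G n (pd g a) (pd g b))"

lemma form_add_right: "form G n a (b + c) = form G n a b + form G n a c"
  by (induction n arbitrary: a b c) (simp_all add: lin_add[OF lin_pd] sum.distrib distrib_left)

lemma form_scale_right: "form G n a (scale c b) = c * form G n a b"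
  by (induction n arbitrary: a b) (simp_all add: lin_scale[OF lin_pd] sum_distrib_left)

lemma form_cnj: "cnj (form G n a b) = form G n b a"
  by (induction n arbitrary: a b) (simp_all add: mult.commute)

lemma form_add_left: "form G n (a + b) c = form G n a c + form G n b c"
  using form_add_right[of G n c a b] by (metis complex_cnj_add form_cnj)

lemma form_scale_left: "form G n (scale c a) b = cnj c * form G n a b"
  using form_scale_right[of G n b c a] by (metis complex_cnj_mult form_cnj)

lemma form_0_right [simp]: "form G n a 0 = 0"
  using form_scale_right[of G n a 0 0] by simp

lemma form_0_left [simp]: "form G n 0 a = 0"
  using form_scale_left[of G n 0 0 a] by simp

lemma form_diff_right: "form G n a (b - c) = form G n a b - form G n a c"
  using form_add_right[of G n a "b - c" c] by simp

lemma form_pos: "\<exists>r\<ge>0. form G n a a = complex_of_real r"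
proof (induction n arbitrary: a)
  case 0
  have "form G 0 a a = complex_of_real ((cmod (counit a))\<^sup>2)"
    using complex_norm_square[of "counit a"] by (simp add: mult.commute)
  then show ?case by (intro exI[of _ "(cmod (counit a))\<^sup>2"]) simp
next
  case (Suc n)
  then obtain r where r: "\<And>a. r a \<ge> 0" "\<And>a. form G n a a = complex_of_real (r a)" by metis
  then show ?case
    by (intro exI[of _ "\<Sum>g\<in>G. r (pd g a)"]) (simp add: sum_nonneg)
qed

text \<open>A vanishing sum of nonnegative terms has vanishing terms; by induction all first
  derivatives are 0, and Euler's identity gives \<open>a = 0\<close>.\<close>

lemma form_definite:
  assumes G: "finite G"
  shows "a \<in> sv.span (mon ` {w. set w \<subseteq> G \<and> length w = n}) \<Longrightarrow> form G n a a = 0 \<Longrightarrow> a = 0"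
proof (induction n arbitrary: a)
  case 0
  have "mon ` {w. set w \<subseteq> G \<and> length w = 0} = {1}" by auto
  then obtain c where a: "a = scale c 1"
    using "0.prems"(1) by (auto simp: sv.span_singleton)
  have "c = 0" using "0.prems"(2) by (simp add: a)
  then show ?case by (simp add: a)
next
  case (Suc n)
  obtain r where r: "\<And>a. r a \<ge> 0" "\<And>a. form G n a a = complex_of_real (r a)"
    using form_pos[of G n] by metis
  have "complex_of_real (\<Sum>g\<in>G. r (pd g a)) = 0" using Suc.prems(2) by (simp add: r)
  then have "(\<Sum>g\<in>G. r (pd g a)) = 0" by (simp only: of_real_eq_0_iff)
  then have r0: "r (pd g a) = 0" if "g \<in> G" for g
    using that G r(1) by (simp add: sum_nonneg_eq_0_iff)
  have "pd g a = 0" if "g \<in> G" for g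
  proof (rule Suc.IH)
    show "form G n (pd g a) (pd g a) = 0" using r0[OF that] by (simp add: r(2))
    show "pd g a \<in> sv.span (mon ` {w. set w \<subseteq> G \<and> length w = n})"
      using Suc.prems(1)
    proof (rule lin_span[OF lin_pd])
      fix z assume "z \<in> mon ` {w. set w \<subseteq> G \<and> length w = Suc n}"
      then obtain w where w: "z = mon w" "set w \<subseteq> G" "length w = Suc n" by blast
      have "{mon (u @ v) | u v. w = u @ g # v} \<subseteq> mon ` {w. set w \<subseteq> G \<and> length w = n}"
        using w by auto
      then show "pd g z \<in> sv.span (mon ` {w. set w \<subseteq> G \<and> length w = n})"
        unfolding w(1) by (rule set_mp[OF sv.span_mono pd_mon])
    qed
  qed
  moreover have "a \<in> sv.span (mon ` {w. count_in G w = Suc n})"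
    using Suc.prems(1) by (rule set_mp[OF sv.span_mono, rotated]) (auto simp: count_in_eq_length)
  ultimately have "scale (of_nat (Suc n)) a = 0"
    using euler[OF G, of a "Suc n"] by simp
  then show ?case by (simp del: of_nat_Suc)
qed

lemma form_eq_0_span:
  assumes "\<And>q. q \<in> B \<Longrightarrow> form G n q a = 0" "p \<in> sv.span B"
  shows "form G n p a = 0"
  using assms(2)
  by (induction rule: sv.span_induct_alt) (simp_all add: form_add_left form_scale_left assms(1))

text \<open>Gram-Schmidt, adding one spanning vector at a time; definiteness on the span guarantees
  that the divisions make sense.\<close>

lemma form_projection:
  assumes "finite B" "\<And>v. v \<in> sv.span B \<Longrightarrow> form G n v v = 0 \<Longrightarrow> v = 0"
  shows "\<exists>p\<in>sv.span B. \<forall>q\<in>sv.span B. form G n q (a - p) = 0"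
proof -
  have "\<exists>p\<in>sv.span B. \<forall>q\<in>B. form G n q (a - p) = 0"
    using assms
  proof (induction B arbitrary: a rule: finite_induct)
    case empty
    then show ?case by (auto simp: sv.span_zero)
  next
    case (insert v B)
    have def: "v' = 0" if "v' \<in> sv.span B" "form G n v' v' = 0" for v'
      using insert.prems[of v'] that sv.span_mono[of B "insert v B"] by blast
    obtain p where p: "p \<in> sv.span B" "\<And>q. q \<in> B \<Longrightarrow> form G n q (a - p) = 0"
      using insert.IH[of a] def by blast
    obtain pv where pv: "pv \<in> sv.span B" "\<And>q. q \<in> B \<Longrightarrow> form G n q (v - pv) = 0"
      using insert.IH[of v] def by blast
    define e where "e = v - pv"
    \<comment> \<open>If the denominator is 0, then \<open>e = 0\<close> by definiteness; the
      numerator is 0 as well and the quotient is 0 by convention, so the equation for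
      \<open>c\<close> below still holds.\<close>
    define c where "c = form G n e (a - p) / form G n e e"
    have sub: "x \<in> sv.span (insert v B)" if "x \<in> sv.span B" for x
      using that sv.span_mono[of B "insert v B"] by blast
    have e_span: "e \<in> sv.span (insert v B)"
      unfolding e_def by (rule sv.span_diff[OF sv.span_base sub[OF pv(1)]]) simp
    have "e = 0" if "form G n e e = 0" using insert.prems[of e] e_span that by simp
    then have e: "form G n e (a - p) = c * form G n e e" by (auto simp: c_def)
    have q: "form G n q (a - (p + scale c e)) = 0" if "q \<in> sv.span B" for q
    proof -
      have "form G n q (a - p) = 0" "form G n q e = 0"
        using form_eq_0_span[OF p(2) that] form_eq_0_span[OF pv(2) that] by (simp_all add: e_def)
      then show ?thesis by (simp add: form_diff_right form_add_right form_scale_right)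
    qed
    \<comment> \<open>The vectors \<open>v\<close> and \<open>e\<close> differ by \<open>pv\<close>,
      which lies in the span of \<open>B\<close> and is already orthogonal to the new
      difference.\<close>
    have "form G n v (a - (p + scale c e)) = form G n e (a - (p + scale c e))"
      using q[OF pv(1)] form_add_left[of G n e pv] by (simp add: e_def)
    also have "\<dots> = 0"
      using e by (simp add: form_diff_right form_add_right form_scale_right algebra_simps)
    finally have "\<forall>x\<in>insert v B. form G n x (a - (p + scale c e)) = 0"
      using q by (auto intro: sv.span_base)
    moreover have "p + scale c e \<in> sv.span (insert v B)"
      by (rule sv.span_add[OF sub[OF p(1)] sv.span_scale[OF e_span]])
    ultimately show ?case by blast
  qed
  then show ?thesis using form_eq_0_span by blast
qed

text \<open>The polarization creates \<open>X k i\<close> from \<open>X t i\<close>, so its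
  supercommutator with the derivative along \<open>X k i\<close> is the derivative along
  \<open>X t i\<close>; with all other derivatives it is 0.\<close>

lemma pd_pol:
  "pd g (pol k t a) = scale (koszul (is_odd g) (is_odd k \<noteq> is_odd t)) (pol k t (pd g a))
    + (case g of X k' i \<Rightarrow> if k' = k then pd (X t i) a else 0 | Xd i s \<Rightarrow> 0)"
proof -
  let ?d = "is_odd k \<noteq> is_odd t"
  let ?E = "\<lambda>a. case g of X k' i \<Rightarrow> if k' = k then pd (X t i) a else 0 | Xd i s \<Rightarrow> 0"
  have E: "sder (is_odd g \<noteq> ?d) ?E"
  proof (cases "\<exists>i. g = X k i")
    case True
    then obtain i where i: "g = X k i" by blast
    have "(is_odd g \<noteq> ?d) = is_odd (X t i)" by (auto simp: i)
    then show ?thesis using sder_pd[of "X t i"] by (simp add: i)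
  next
    case False
    then have "?E = (\<lambda>a. 0)" by (auto split: gen.splits)
    then show ?thesis by (simp only: sder_0)
  qed
  have "pd g (pol k t a) - scale (koszul (is_odd g) ?d) (pol k t (pd g a)) = ?E a"
  proof (rule sder_eqI[OF sder_supercommutator[OF sder_pd sder_pol] E])
    fix h
    have "pol k t (pd g (sgen h)) = 0"
      by (simp add: pd_sgen sder_1[OF sder_pol] lin_0[OF lin_pol])
    then show "pd g (pol k t (sgen h)) - scale (koszul (is_odd g) ?d) (pol k t (pd g (sgen h)))
        = ?E (sgen h)"
      by (cases h; cases g) (auto simp: pol_X pol_Xd pd_sgen lin_0[OF lin_pd])
  qed
  then show ?thesis by (simp add: algebra_simps)
qed

lemma sum_gset_X:
  fixes h :: "idx \<Rightarrow> complex"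
  assumes "finite (gset T S I)" "k \<in> T"
  shows "(\<Sum>g\<in>gset T S I. case g of X k' i \<Rightarrow> if k' = k then h i else 0 | Xd i s \<Rightarrow> 0) = (\<Sum>i\<in>I. h i)"
    (is "sum ?f _ = _")
proof -
  have "sum ?f (gset T S I) = sum ?f (X k ` I)"
    using assms by (intro sum.mono_neutral_right) (auto split: gen.splits)
  also have "\<dots> = (\<Sum>i\<in>I. h i)" by (subst sum.reindex) (auto simp: inj_on_def)
  finally show ?thesis .
qed

text \<open>Induction on the degree. Commuting the polarization past a derivative gives the same
  real sign on both sides, and the extra terms are on both sides the pairings of
  \<open>pd (X t i) a\<close> with \<open>pd (X k i) b\<close>. In degree 0 both sides vanish, as
  polarized elements have no constant term.\<close>

lemma form_pol:
  assumes G: "finite (gset T S I)" and k: "k \<in> T" and t: "t \<in> T"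
  shows "form (gset T S I) n (pol k t a) b = form (gset T S I) n a (pol t k b)"
proof (induction n arbitrary: a b)
  case 0
  have "counit (pol k t a) = 0" for k t and a :: "gen symalg"
  proof -
    have "pol k t a \<in> sv.span (mon ` {w. w \<noteq> []})"
      using span_mon[of a]
    proof (rule lin_span[OF lin_pol])
      fix z :: "gen symalg" assume "z \<in> range mon"
      then obtain w where "z = mon w" by blast
      have "{mon (u @ X k i # v) | u v i. w = u @ X t i # v} \<subseteq> mon ` {w. w \<noteq> []}" by auto
      then show "pol k t z \<in> sv.span (mon ` {w. w \<noteq> []})"
        unfolding \<open>z = mon w\<close> by (rule set_mp[OF sv.span_mono pol_mon])
    qed
    then show ?thesis
      by (induction rule: sv.span_induct_alt) (auto simp: counit_mon)
  qed
  then show ?case by simp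
next
  case (Suc n)
  let ?G = "gset T S I" and ?f = "form (gset T S I) n"
  let ?s = "\<lambda>g. koszul (is_odd g) (is_odd k \<noteq> is_odd t)"
  have cnj_s: "cnj (?s g) = ?s g" for g :: gen by (simp add: koszul_def)
  have sym: "koszul (is_odd g) (is_odd t \<noteq> is_odd k) = ?s g" for g :: gen by (auto simp: koszul_def)
  have "form ?G (Suc n) (pol k t a) b = (\<Sum>g\<in>?G. ?s g * ?f (pol k t (pd g a)) (pd g b))
      + (\<Sum>g\<in>?G. case g of X k' i \<Rightarrow> if k' = k then ?f (pd (X t i) a) (pd (X k i) b) else 0 | Xd i s \<Rightarrow> 0)"
    unfolding form.simps sum.distrib[symmetric] pd_pol form_add_left form_scale_left cnj_s
    by (intro sum.cong refl arg_cong2[of _ _ _ _ "(+)"]) (auto split: gen.splits)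
  also have "\<dots> = (\<Sum>g\<in>?G. ?s g * ?f (pd g a) (pol t k (pd g b)))
      + (\<Sum>i\<in>I. ?f (pd (X t i) a) (pd (X k i) b))"
    by (simp add: sum_gset_X[OF G k] Suc.IH)
  also have "\<dots> = (\<Sum>g\<in>?G. ?s g * ?f (pd g a) (pol t k (pd g b)))
      + (\<Sum>g\<in>?G. case g of X k' i \<Rightarrow> if k' = t then ?f (pd (X t i) a) (pd (X k i) b) else 0 | Xd i s \<Rightarrow> 0)"
    by (simp add: sum_gset_X[OF G t])
  also have "\<dots> = form ?G (Suc n) a (pol t k b)"
    unfolding form.simps sum.distrib[symmetric] pd_pol form_add_right form_scale_right sym
    by (intro sum.cong refl arg_cong2[of _ _ _ _ "(+)"]) (auto split: gen.splits)
  finally show ?case .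
qed

section \<open>Reduction of an arbitrary \<open>U\<close> to the copy\<close>

context doubled_index
begin

lemma length_W:
  assumes "w \<in> W a b c"
  shows "length w = a + b + c"
proof -
  have "count_in (gset T {} I) w + count_in (gset (\<iota> ` I) {} I) w + count_in (gset {} S I) w = length w"
    if "set w \<subseteq> gset (T \<union> \<iota> ` I) S I" for w
    using that
  proof (induction w)
    case (Cons g w)
    then show ?case using not_copy by (cases g) auto
  qed simp
  then show ?thesis using assms by (auto simp: W_def)
qed

lemma mspan_words:
  "mspan a b c \<subseteq> sv.span (mon ` {w. set w \<subseteq> gset (T \<union> \<iota> ` I) S I \<and> length w = a + b + c})"
  unfolding mspan_def by (intro sv.span_mono image_mono) (auto simp: length_W, auto simp: W_def)

definition to_copy :: "(idx \<times> idx) list \<Rightarrow> gen symalg \<Rightarrow> gen symalg"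
  where "to_copy = foldr (\<lambda>(t, j). pol (\<iota> j) t)"

text \<open>The reverse polarizations in the reverse order, hence the adjoint of
  \<open>to_copy\<close> for the Fischer form.\<close>

definition from_copy :: "(idx \<times> idx) list \<Rightarrow> gen symalg \<Rightarrow> gen symalg"
  where "from_copy ps a = foldl (\<lambda>a (t, j). pol t (\<iota> j) a) a ps"

lemma to_copy_mspan:
  "set ps \<subseteq> T \<times> I \<Longrightarrow> x \<in> mspan (length ps + a) b c \<Longrightarrow> to_copy ps x \<in> mspan a (length ps + b) c"
proof (induction ps arbitrary: a)
  case (Cons p ps)
  obtain t j where p: "p = (t, j)" "t \<in> T" "j \<in> I" using Cons.prems(1) by (cases p) auto
  have "to_copy ps x \<in> mspan (Suc a) (length ps + b) c"
    using Cons.prems by (intro Cons.IH) auto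
  then show ?case using p by (simp add: to_copy_def pol_mspan_to_copy)
qed (simp add: to_copy_def)

lemma from_copy_pspan:
  "set ps \<subseteq> T \<times> I \<Longrightarrow> x \<in> pspan a (length ps + b) \<Longrightarrow> from_copy ps x \<in> pspan (length ps + a) b"
proof (induction ps arbitrary: a x)
  case (Cons p ps)
  obtain t j where p: "p = (t, j)" "t \<in> T" "j \<in> I" using Cons.prems(1) by (cases p) auto
  have "pol t (\<iota> j) x \<in> pspan (Suc a) (length ps + b)"
    using Cons.prems p by (intro pol_pspan_from_copy) auto
  then have "from_copy ps (pol t (\<iota> j) x) \<in> pspan (length ps + Suc a) b"
    using Cons.prems by (intro Cons.IH) auto
  then show ?case using p by (simp add: from_copy_def)
qed (simp add: from_copy_def)

lemma form_copy:
  "set ps \<subseteq> T \<times> I \<Longrightarrow> form (gset (T \<union> \<iota> ` I) S I) n (to_copy ps x) y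
    = form (gset (T \<union> \<iota> ` I) S I) n x (from_copy ps y)"
proof (induction ps arbitrary: y)
  case (Cons p ps)
  obtain t j where p: "p = (t, j)" "t \<in> T" "j \<in> I" using Cons.prems(1) by (cases p) auto
  have "finite (gset (T \<union> \<iota> ` I) S I)" using fin by (intro finite_gset) auto
  then have "form (gset (T \<union> \<iota> ` I) S I) n (pol (\<iota> j) t (to_copy ps x)) y
    = form (gset (T \<union> \<iota> ` I) S I) n (to_copy ps x) (pol t (\<iota> j) y)"
    using p by (intro form_pol) auto
  then show ?case using Cons p by (simp add: to_copy_def from_copy_def)
qed (simp add: to_copy_def from_copy_def)

lemma ev_to_copy:
  "set ps \<subseteq> T \<times> I \<Longrightarrow> ev (to_copy ps x) = pds (map (case_prod X) ps) (ev x)"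
  by (induction ps) (auto simp: to_copy_def ev_pol)

lemma annihilated_to_copy: "annihilated I x \<Longrightarrow> annihilated I (to_copy ps x)"
  by (induction ps) (auto simp: to_copy_def pol_def intro: annihilated_derU)

text \<open>The component \<open>e\<close> of \<open>x\<close> orthogonal to the products of scalar products is moved into the
  copy of \<open>I\<close>, where it is a combination of products of scalar products which is orthogonal to
  itself.\<close>

lemma annihilated_imp_pspan:
  assumes x: "x \<in> mspan r 0 r" and inv: "annihilated I x"
  shows "x \<in> pspan r 0"
proof -
  let ?G = "gset (T \<union> \<iota> ` I) S I"
  have G: "finite ?G" using fin by (intro finite_gset) auto
  \<comment> \<open>The form is used in degree \<open>r + r\<close>, the total degree of words with
    \<open>r\<close> letters \<open>x\<close>, copied or not, and \<open>r\<close> letters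
    \<open>x\<^sup>*\<close>.\<close>
  have definite: "y = 0" if "y \<in> mspan a b r" "a + b = r" "form ?G (r + r) y y = 0" for y a b
    using form_definite[OF G, of y "r + r"] that mspan_words[of a b r] by auto
  have "PW r 0 \<subseteq> {w. set w \<subseteq> (T \<union> \<iota> ` I) \<times> S \<and> length w = r}"
    unfolding PW_def using count_in_pairs by fastforce
  moreover have "finite {w. set w \<subseteq> (T \<union> \<iota> ` I) \<times> S \<and> length w = r}"
    using fin by (intro finite_lists_length_eq) auto
  ultimately have "finite (spl I ` PW r 0)" by (blast intro: finite_subset)
  then have "\<exists>p\<in>sv.span (spl I ` PW r 0). \<forall>q\<in>sv.span (spl I ` PW r 0). form ?G (r + r) q (x - p) = 0"
  proof (rule form_projection)
    fix v assume "v \<in> sv.span (spl I ` PW r 0)" "form ?G (r + r) v v = 0"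
    then show "v = 0" using definite[of v r 0] pspan_mspan[of r 0] by (auto simp: pspan_def)
  qed
  then obtain p where p: "p \<in> pspan r 0" "\<And>q. q \<in> pspan r 0 \<Longrightarrow> form ?G (r + r) q (x - p) = 0"
    unfolding pspan_def by blast
  define e where "e = x - p"
  have pm: "p \<in> mspan r 0 r" using p(1) pspan_mspan[of r 0] by auto
  have e: "e \<in> mspan r 0 r" using x pm unfolding e_def mspan_def by (rule sv.span_diff)
  have e_inv: "annihilated I e"
    unfolding e_def using inv annihilated_pspan[OF p(1)] by (rule annihilated_diff)
  \<comment> \<open>As \<open>e\<close> has degree \<open>r\<close> in the original
    \<open>x\<close>, it suffices that its derivatives of order \<open>r\<close> along these vanish;
    they arise by evaluating \<open>to_copy ps e\<close>.\<close>
  have "e = 0"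
  proof (rule pds_eq_0)
    show "finite (gset T {} I)" using fin by (simp add: finite_gset)
    show "e \<in> sv.span (mon ` {w. count_in (gset T {} I) w = r})"
      using e unfolding mspan_def by (rule set_mp[OF sv.span_mono, rotated]) (auto simp: W_def)
    fix ws assume ws: "length ws = r" "set ws \<subseteq> gset T {} I"
    obtain ps where ps: "ws = map (case_prod X) ps" "set ps \<subseteq> T \<times> I"
    proof -
      have "\<exists>ps. ws = map (case_prod X) ps \<and> set ps \<subseteq> T \<times> I" using ws(2)
      proof (induction ws)
        case (Cons g ws)
        then obtain ps where "ws = map (case_prod X) ps" "set ps \<subseteq> T \<times> I" by auto
        moreover obtain t i where "g = X t i" "t \<in> T" "i \<in> I" using Cons.prems by (cases g) auto
        ultimately show ?case by (intro exI[of _ "(t, i) # ps"]) simp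
      qed simp
      then show thesis using that by blast
    qed
    let ?y = "to_copy ps e"
    have len: "length ps = r" using ws(1) ps(1) by simp
    have y: "?y \<in> mspan 0 r r" using to_copy_mspan[OF ps(2), of e 0 0 r] e len by simp
    then have "?y \<in> pspan 0 r" by (intro annihilated_copy_imp_pspan annihilated_to_copy e_inv)
    then have "from_copy ps ?y \<in> pspan r 0"
      using from_copy_pspan[OF ps(2), of ?y 0 0] len by simp
    then have "form ?G (r + r) (from_copy ps ?y) e = 0" unfolding e_def by (rule p(2))
    then have "form ?G (r + r) ?y ?y = 0"
      \<comment> \<open>Adjointness turns this into the pairing of \<open>e\<close> with
        \<open>from_copy ps ?y\<close>, the complex conjugate of the pairing just seen to be
        0.\<close>
      unfolding form_copy[OF ps(2)] by (metis complex_cnj_zero form_cnj)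
    then have "?y = 0" using definite[of ?y 0 r] y by simp
    then have "pds ws (ev e) = 0" using ev_to_copy[OF ps(2), of e] by (simp add: ps(1) lin_0[OF lin_ev])
    then show "pds ws e = 0" by (simp add: ev_mspan_id[OF e])
  qed
  then show ?thesis using p(1) by (simp add: e_def)
qed

text \<open>The bihomogeneous components of bidegree \<open>(r, r)\<close> have degree 0 in the
  copied entries, so \<open>annihilated_imp_pspan\<close> applies to each of them, and the resulting
  products involve rows from \<open>T\<close> only.\<close>

lemma invariant_span_scalar_products:
  assumes "a \<in> invariants T S I (gl I)"
  shows "a \<in> sv.span (prod_list ` lists {scalar_product I t s | t s. t \<in> T \<and> s \<in> S})"
proof (rule invariants_bihomogeneous[OF fin(3) _ assms])
  fix r b
  assume b: "b \<in> sv.span (mon ` {w. set w \<subseteq> gset T S I \<and> bideg w = (r, r)})"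
    and inv: "annihilated I b"
  have "{w. set w \<subseteq> gset T S I \<and> bideg w = (r, r)} \<subseteq> W r 0 r"
  proof -
    have "count_in (gset T {} I) w = fst (bideg w)" "count_in (gset (\<iota> ` I) {} I) w = 0"
      "count_in (gset {} S I) w = snd (bideg w)" if "set w \<subseteq> gset T S I" for w
    proof -
      have "count_in (gset T {} I) w = fst (bideg w) \<and> count_in (gset (\<iota> ` I) {} I) w = 0
        \<and> count_in (gset {} S I) w = snd (bideg w)"
        using that
      proof (induction w)
        case (Cons g w)
        then show ?case using not_copy by (cases g) (auto simp: bideg_def)
      qed (simp add: bideg_def)
      then show "count_in (gset T {} I) w = fst (bideg w)" "count_in (gset (\<iota> ` I) {} I) w = 0"
        "count_in (gset {} S I) w = snd (bideg w)" by blast+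
    qed
    moreover have "gset T S I \<subseteq> gset (T \<union> \<iota> ` I) S I" unfolding gset_def by blast
    ultimately show ?thesis by (auto simp: W_def)
  qed
  then have "b \<in> mspan r 0 r" using b sv.span_mono[OF image_mono] unfolding mspan_def by blast
  then have "b \<in> pspan r 0" using inv by (rule annihilated_imp_pspan)
  moreover have "spl I ` PW r 0 \<subseteq> prod_list ` lists {scalar_product I t s | t s. t \<in> T \<and> s \<in> S}"
  proof (rule image_subsetI)
    fix w assume "w \<in> PW r 0"
    then have "set w \<subseteq> (T \<union> \<iota> ` I) \<times> S" "set w \<inter> (\<iota> ` I \<times> S) = {}"
      by (auto simp: PW_def count_in_eq_0)
    then have "set w \<subseteq> T \<times> S" by blast
    then have "map (case_prod (scalar_product I)) w \<in> lists {scalar_product I t s | t s. t \<in> T \<and> s \<in> S}"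
      by fastforce
    then show "spl I w \<in> prod_list ` lists {scalar_product I t s | t s. t \<in> T \<and> s \<in> S}"
      unfolding spl_def by (rule imageI)
  qed
  ultimately show "b \<in> sv.span (prod_list ` lists {scalar_product I t s | t s. t \<in> T \<and> s \<in> S})"
    unfolding pspan_def using sv.span_mono by blast
qed

end

text \<open>A parity preserving embedding whose values lie beyond \<open>idx_set k l\<close>. The
  \<open>Suc\<close> moves the index 0 out of that set too, as \<open>doubled_index\<close> asks for
  \<open>\<iota> i \<notin> T\<close> for every \<open>i\<close>.\<close>

fun shift :: "nat \<Rightarrow> nat \<Rightarrow> idx \<Rightarrow> idx" where
  "shift k l (Even i) = Even (Suc (i + k))"
| "shift k l (Odd i) = Odd (Suc (i + l))"

theorem theorem1p1:
  fixes n m k l p q :: nat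
  shows "basic_set (idx_set k l) (idx_set p q) (idx_set n m) (gl (idx_set n m))
    {scalar_product (idx_set n m) t s | t s. t \<in> idx_set k l \<and> s \<in> idx_set p q}"
proof (rule basic_setI)
  show "{scalar_product (idx_set n m) t s | t s. t \<in> idx_set k l \<and> s \<in> idx_set p q}
    \<subseteq> invariants (idx_set k l) (idx_set p q) (idx_set n m) (gl (idx_set n m))"
    using scalar_product_invariant by blast
  interpret doubled_index "idx_set k l" "idx_set p q" "idx_set n m" "shift k l"
  proof
    show "inj (shift k l)"
    proof (rule injI)
      show "i = j" if "shift k l i = shift k l j" for i j
        using that by (cases i; cases j) auto
    qed
    show "is_odd (shift k l i) = is_odd i" "shift k l i \<notin> idx_set k l" for i
      by (cases i; auto simp: idx_set_def)+
  qed (simp_all add: idx_set_def)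
  show "a \<in> sv.span (prod_list ` lists
      {scalar_product (idx_set n m) t s | t s. t \<in> idx_set k l \<and> s \<in> idx_set p q})"
    if "a \<in> invariants (idx_set k l) (idx_set p q) (idx_set n m) (gl (idx_set n m))" for a
    using that by (rule invariant_span_scalar_products)
qed

end
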